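(* There exists a compactly supported Borel probability measure $\mu$ on $\mathbb R$ which is singular with respect to Lebesgue measure and has no atoms, such that every mutually orthogonal set of exponentials for $\mu$ is finite (in particular, $\mu$ is not a spectral measure), but $\mu$ is a frame spectral measure.
   Context: Let $\mu$ be a compactly supported Borel probability measure on $\mathbb R$. A set $\Lambda\subset\mathbb R$ is a mutually orthogonal set (of exponentials) for $\mu$ if the functions $e^{2\pi i\lambda x}$, $\lambda\in\Lambda$, are pairwise orthogonal in $L^2(\mu)$, i.e. $\int e^{2\pi i(\lambda-\lambda')x}d\mu(x)=0$ for all distinct $\lambda,\lambda'\in\Lambda$. The measure $\mu$ is spectral if there is $\Lambda\subset\mathbb R$ such that $\{e^{2\pi i\lambda x}\}_{\lambda\in\Lambda}$ is an orthonormal basis of $L^2(\mu)$. It is frame spectral (admits a Fourier frame) if there are $\Lambda\subset\mathbb R$ and constants $0<A\le B<\infty$ with $A\|f\|_{L^2(\mu)}^2\le\sum_{\lambda\in\Lambda}\left|\int f(x)e^{-2\pi i\lambda x}d\mu(x)\right|^2\le B\|f\|_{L^2(\mu)}^2$ for all $f\in L^2(\mu)$. *)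

theory Defs
  imports "HOL-Probability.Probability"
begin

definition measure_support :: "'a::topological_space measure \<Rightarrow> 'a set" where
  "measure_support M = {x. \<forall>U. open U \<longrightarrow> x \<in> U \<longrightarrow> emeasure M U > 0}"

definition mutually_singular :: "'a measure \<Rightarrow> 'a measure \<Rightarrow> bool" where
  "mutually_singular M N \<longleftrightarrow>
     (\<exists>S \<in> sets M \<inter> sets N. emeasure M S = 0 \<and> emeasure N (space N - S) = 0)"

text \<open>For a Borel measure on the real line, an atom is a point of positive mass.\<close>

definition atomless :: "real measure \<Rightarrow> bool" where
  "atomless M \<longleftrightarrow> (\<forall>x. emeasure M {x} = 0)"

text \<open>Elements of \<open>L\<^sup>2(M)\<close> are represented by functions; all notions below depend only on the
  class of the function modulo equality almost everywhere.\<close>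

definition L2 :: "'a measure \<Rightarrow> ('a \<Rightarrow> complex) set" where
  "L2 M = {f \<in> borel_measurable M. integrable M (\<lambda>x. (cmod (f x))\<^sup>2)}"

definition L2_inner :: "'a measure \<Rightarrow> ('a \<Rightarrow> complex) \<Rightarrow> ('a \<Rightarrow> complex) \<Rightarrow> complex" where
  "L2_inner M f g = (CLINT x|M. f x * cnj (g x))"

definition L2_norm :: "'a measure \<Rightarrow> ('a \<Rightarrow> complex) \<Rightarrow> real" where
  "L2_norm M f = sqrt (LINT x|M. (cmod (f x))\<^sup>2)"

definition expo :: "real \<Rightarrow> real \<Rightarrow> complex" where
  "expo t = (\<lambda>x. iexp (2 * pi * t * x))"

definition mutually_orthogonal_set :: "real measure \<Rightarrow> real set \<Rightarrow> bool" where
  "mutually_orthogonal_set M \<Lambda> \<longleftrightarrow>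
     pairwise (\<lambda>s t. L2_inner M (expo s) (expo t) = 0) \<Lambda>"

text \<open>An orthonormal basis in the Hilbert space sense: an orthonormal family whose finite linear
  combinations are dense.\<close>

definition L2_orthonormal_basis :: "'a measure \<Rightarrow> ('i \<Rightarrow> 'a \<Rightarrow> complex) \<Rightarrow> 'i set \<Rightarrow> bool" where
  "L2_orthonormal_basis M e I \<longleftrightarrow>
     (\<forall>i\<in>I. e i \<in> L2 M) \<and>
     (\<forall>i\<in>I. \<forall>j\<in>I. L2_inner M (e i) (e j) = (if i = j then 1 else 0)) \<and>
     (\<forall>f \<in> L2 M. \<forall>\<epsilon>>0. \<exists>F c. finite F \<and> F \<subseteq> I \<and>
        L2_norm M (\<lambda>x. f x - (\<Sum>i\<in>F. c i * e i x)) < \<epsilon>)"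

definition spectral_measure :: "real measure \<Rightarrow> bool" where
  "spectral_measure M \<longleftrightarrow> (\<exists>\<Lambda>. L2_orthonormal_basis M expo \<Lambda>)"

text \<open>Summability is stated explicitly because \<open>infsum\<close> is \<open>0\<close> on non-summable families.\<close>

definition frame_spectral_measure :: "real measure \<Rightarrow> bool" where
  "frame_spectral_measure M \<longleftrightarrow>
     (\<exists>\<Lambda> A B. 0 < A \<and> A \<le> B \<and>
       (\<forall>f \<in> L2 M.
          (\<lambda>t. (cmod (CLINT x|M. f x * expo (- t) x))\<^sup>2) summable_on \<Lambda> \<and>
          A * (L2_norm M f)\<^sup>2 \<le> (\<Sum>\<^sub>\<infinity>t\<in>\<Lambda>. (cmod (CLINT x|M. f x * expo (- t) x))\<^sup>2) \<and>
          (\<Sum>\<^sub>\<infinity>t\<in>\<Lambda>. (cmod (CLINT x|M. f x * expo (- t) x))\<^sup>2) \<le> B * (L2_norm M f)\<^sup>2))"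

end

theory Submission
  imports Defs
begin

text \<open>
  Let \<open>\<mu>\<close> be the law of \<open>X = \<Sum>n. b\<^sub>n / (2 * 4^n)\<close> with independent fair bits \<open>b\<^sub>n\<close>: the Jorgensen--Pedersen
  Cantor measure, which lives on \<open>{0..2/3}\<close> and is self-similar under \<open>x \<mapsto> x/4\<close> and \<open>x \<mapsto> x/4 + 1/2\<close>.
  The measure asked for is \<open>\<mu>\<close> with the density \<open>e^x\<close>, normalised. As the density is bounded above
  and away from \<open>0\<close>, a Fourier frame for \<open>\<mu>\<close> remains one. But \<open>F z = \<integral> e^(z x) d\<mu>\<close> satisfies
  \<open>F z = (1 + e^(z/2)) / 2 * F (z/4)\<close> and \<open>F (z/4^n) \<longlonglongrightarrow> 1\<close>, so that all its zeros lie on \<open>Re z = 0\<close>. The tilt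
  moves the Fourier transform to the line \<open>Re z = 1\<close>, and no two exponentials are orthogonal.

  The frame for \<open>\<mu>\<close> consists of the frequencies \<open>\<Sum>k<n. l\<^sub>k 4^k\<close> with \<open>l\<^sub>k \<in> {0,1}\<close>. Splitting \<open>f\<close> into half the sum
  and half the (modulated) difference of its two rescaled halves splits the frequencies according to
  \<open>l\<^sub>0\<close> and preserves the total norm, which gives Bessel's inequality by induction on \<open>n\<close>. On functions
  that are constant on the cylinders of level \<open>n\<close>, the same induction ends with the integrals of
  \<open>e^(-2\<pi>i\<theta>x)\<close> with \<open>\<theta> \<in> {0..1/3}\<close>, whose modulus is at least \<open>cos (4\<pi>/9) > 0\<close>; density of the step functions then
  gives the lower frame bound.
\<close>

section \<open>The quarter Cantor measure\<close>

definition digit_sum :: "(nat \<Rightarrow> bool) \<Rightarrow> real" where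
  "digit_sum \<omega> = (\<Sum>n. if \<omega> n then (1/2) * (1/4) ^ n else 0)"

abbreviation coin :: "bool measure" where
  "coin \<equiv> measure_pmf (bernoulli_pmf (1/2))"

definition cantor :: "real measure" where
  "cantor = distr (\<Pi>\<^sub>M i\<in>(UNIV::nat set). coin) borel digit_sum"

interpretation coins: sequence_space coin
  by unfold_locales

interpretation coin_coins: pair_prob_space coin coins.S
  by unfold_locales

lemma sums_quarter_powers: "(\<lambda>n. (1/2) * (1/4) ^ n) sums (2/3 :: real)"
  using sums_mult[OF geometric_sums[of "1/4::real"], of "1/2"] by simp

lemma summable_digit_sum: "summable (\<lambda>n. if \<omega> n then (1/2) * (1/4::real) ^ n else 0)"
  by (rule summable_comparison_test_ev[OF _ sums_summable[OF sums_quarter_powers]]) auto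

lemma digit_sum_nonneg: "0 \<le> digit_sum \<omega>"
  unfolding digit_sum_def by (intro suminf_nonneg summable_digit_sum) auto

lemma digit_sum_le: "digit_sum \<omega> \<le> 2/3"
  unfolding digit_sum_def sums_unique[OF sums_quarter_powers]
  by (intro suminf_le summable_digit_sum sums_summable[OF sums_quarter_powers]) auto

lemma digit_sum_case_nat:
  "digit_sum (case_nat b \<omega>) = (if b then 1/2 else 0) + digit_sum \<omega> / 4"
proof -
  let ?f = "\<lambda>n. if case_nat b \<omega> n then (1/2) * (1/4::real) ^ n else 0"
  have "(\<Sum>n. ?f n) = ?f 0 + (\<Sum>n. ?f (Suc n))"
    using suminf_split_head[OF summable_digit_sum[of "case_nat b \<omega>"]] by simp
  also have "(\<Sum>n. ?f (Suc n)) = (\<Sum>n. (if \<omega> n then (1/2) * (1/4) ^ n else 0) / 4)"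
    by (intro arg_cong[where f = suminf] ext) simp
  finally show ?thesis
    unfolding digit_sum_def by (simp add: suminf_divide[OF summable_digit_sum])
qed

lemma measurable_digit_sum [measurable]: "digit_sum \<in> borel_measurable coins.S"
  unfolding digit_sum_def [abs_def] by measurable

lemma sets_cantor [measurable_cong, simp]: "sets cantor = sets borel"
  by (simp add: cantor_def)

lemma space_cantor [simp]: "space cantor = UNIV"
  by (simp add: cantor_def)

interpretation cantor: prob_space cantor
  unfolding cantor_def by (rule coins.P.prob_space_distr) measurable

lemma AE_cantor: "AE x in cantor. x \<in> {0..2/3}"
  unfolding cantor_def by (subst AE_distr_iff) (simp_all add: digit_sum_nonneg digit_sum_le del: le_divide_eq_numeral1)

text \<open>A fair toss put in front of an independent sequence of fair tosses gives the product law
  again (\<open>coins.PiM_iter\<close>), and \<open>digit_sum_case_nat\<close> shows what this does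
  to the digit sum. All uses of self-similarity start here.\<close>

lemma cantor_step: "cantor = distr (coin \<Otimes>\<^sub>M coins.S) borel (\<lambda>(b, \<omega>). (if b then 1/2 else 0) + digit_sum \<omega> / 4)"
proof -
  have "cantor = distr (distr (coin \<Otimes>\<^sub>M coins.S) coins.S (\<lambda>(s, \<omega>). case_nat s \<omega>)) borel digit_sum"
    by (simp add: cantor_def coins.PiM_iter)
  also have "\<dots> = distr (coin \<Otimes>\<^sub>M coins.S) borel (digit_sum \<circ> (\<lambda>(s, \<omega>). case_nat s \<omega>))"
    by (rule distr_distr) measurable
  finally show ?thesis
    by (simp add: comp_def case_prod_beta' digit_sum_case_nat)
qed

text \<open>Fubini with the first toss outermost. The version for nonnegative functions has no
  integrability condition, so it can be used to prove integrability of the two halves.\<close>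

lemma nn_integral_cantor:
  assumes [measurable]: "f \<in> borel_measurable borel"
  shows "(\<integral>\<^sup>+x. f x \<partial>cantor) = ((\<integral>\<^sup>+x. f (x/4) \<partial>cantor) + (\<integral>\<^sup>+x. f (x/4 + 1/2) \<partial>cantor)) / 2"
proof -
  have "(\<integral>\<^sup>+x. f x \<partial>cantor)
      = (\<integral>\<^sup>+b. (\<integral>\<^sup>+\<omega>. f ((if b then 1/2 else 0) + digit_sum \<omega> / 4) \<partial>coins.S) \<partial>coin)"
    by (subst cantor_step, subst nn_integral_distr)
       (simp_all add: coins.P.nn_integral_fst[symmetric] case_prod_beta')
  also have "\<dots> = ((\<integral>\<^sup>+\<omega>. f (digit_sum \<omega> / 4) \<partial>coins.S) + (\<integral>\<^sup>+\<omega>. f (digit_sum \<omega> / 4 + 1/2) \<partial>coins.S)) * ennreal (1/2)"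
    by (simp add: add.commute distrib_left distrib_right mult.commute)
  also have "\<dots> = ((\<integral>\<^sup>+x. f (x/4) \<partial>cantor) + (\<integral>\<^sup>+x. f (x/4 + 1/2) \<partial>cantor)) * ennreal (1/2)"
    unfolding cantor_def by (simp add: nn_integral_distr)
  also have "ennreal (1/2) = inverse 2"
    by (metis ennreal_numeral inverse_ennreal inverse_eq_divide zero_less_numeral)
  finally show ?thesis
    by (simp add: divide_ennreal_def)
qed

lemma integral_cantor:
  fixes f :: "real \<Rightarrow> 'b::{banach, second_countable_topology}"
  assumes "integrable cantor f"
  shows "(\<integral>x. f x \<partial>cantor) = ((\<integral>x. f (x/4) \<partial>cantor) + (\<integral>x. f (x/4 + 1/2) \<partial>cantor)) /\<^sub>R 2"
proof -
  have [measurable]: "f \<in> borel_measurable borel"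
    using assms borel_measurable_integrable measurable_cong_sets sets_cantor by blast
  have int: "integrable (coin \<Otimes>\<^sub>M coins.S) (\<lambda>(b, \<omega>). f ((if b then 1/2 else 0) + digit_sum \<omega> / 4))"
    using assms by (subst (asm) cantor_step, subst (asm) integrable_distr_eq)
      (auto simp: case_prod_beta')
  have "(\<integral>x. f x \<partial>cantor)
      = (\<integral>b. (\<integral>\<omega>. f ((if b then 1/2 else 0) + digit_sum \<omega> / 4) \<partial>coins.S) \<partial>coin)"
    by (subst cantor_step, subst integral_distr)
       (use coin_coins.integral_fst'[OF int] in \<open>simp_all add: case_prod_beta'\<close>)
  also have "\<dots> = ((\<integral>\<omega>. f (digit_sum \<omega> / 4) \<partial>coins.S) + (\<integral>\<omega>. f (digit_sum \<omega> / 4 + 1/2) \<partial>coins.S)) /\<^sub>R 2"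
    by (subst integral_measure_pmf[of UNIV]) (auto simp: UNIV_bool scaleR_add_right add.commute)
  also have "\<dots> = ((\<integral>x. f (x/4) \<partial>cantor) + (\<integral>x. f (x/4 + 1/2) \<partial>cantor)) /\<^sub>R 2"
    unfolding cantor_def by (simp add: integral_distr)
  finally show ?thesis .
qed

text \<open>If the average of two nonnegative integrals is finite, then so is each of them.\<close>

lemma integrable_cantor_halves:
  fixes f :: "real \<Rightarrow> 'b::{banach, second_countable_topology}"
  assumes "integrable cantor f"
  shows "integrable cantor (\<lambda>x. f (x/4))" "integrable cantor (\<lambda>x. f (x/4 + 1/2))"
proof -
  have m[measurable]: "f \<in> borel_measurable borel"
    using assms borel_measurable_integrable measurable_cong_sets sets_cantor by blast
  have "(\<integral>\<^sup>+x. norm (f x) \<partial>cantor) < \<infinity>"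
    using assms by (simp add: integrable_iff_bounded)
  then have "(\<integral>\<^sup>+x. norm (f (x/4)) \<partial>cantor) + (\<integral>\<^sup>+x. norm (f (x/4 + 1/2)) \<partial>cantor) < \<infinity>"
    by (subst (asm) nn_integral_cantor) (auto simp: ennreal_divide_eq_top_iff less_top[symmetric])
  then show "integrable cantor (\<lambda>x. f (x/4))" "integrable cantor (\<lambda>x. f (x/4 + 1/2))"
    by (auto simp: integrable_iff_bounded less_top[symmetric])
qed

lemma integrable_cantor_bounded:
  fixes f :: "real \<Rightarrow> 'b::{banach, second_countable_topology}"
  assumes "f \<in> borel_measurable borel" and "\<And>x. x \<in> {0..2/3} \<Longrightarrow> norm (f x) \<le> B"
  shows "integrable cantor f"
proof (rule cantor.integrable_const_bound)
  show "AE x in cantor. norm (f x) \<le> B"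
    using AE_cantor by eventually_elim (rule assms)
qed (use assms in simp)

section \<open>Absence of atoms and singularity to Lebesgue measure\<close>

lemma measure_cantor:
  assumes [measurable]: "A \<in> sets borel"
  shows "measure cantor A = (measure cantor {x. x/4 \<in> A} + measure cantor {x. x/4 + 1/2 \<in> A}) / 2"
proof -
  have "(LINT x|cantor. indicat_real A x) =
     ((LINT x|cantor. indicat_real A (x/4)) + (LINT x|cantor. indicat_real A (x/4 + 1/2))) /\<^sub>R 2"
    by (rule integral_cantor, rule integrable_cantor_bounded[of _ 1]) (auto simp: indicator_def)
  moreover have "indicat_real A (x/4) = indicat_real {x. x/4 \<in> A} x"
    "indicat_real A (x/4 + 1/2) = indicat_real {x. x/4 + 1/2 \<in> A} x" for x
    by (auto simp: indicator_def)
  ultimately show ?thesis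
    by simp
qed

lemma measure_cantor_outside:
  assumes "A \<in> sets borel" and "A \<inter> {0..2/3} = {}"
  shows "measure cantor A = 0"
proof -
  have "AE x in cantor. x \<notin> A"
    using AE_cantor by eventually_elim (use assms in blast)
  then show ?thesis
    using assms by (simp add: cantor.prob_eq_0)
qed

text \<open>At most one of the two preimages \<open>4 * x\<close> and \<open>4 * x - 2\<close> lies
  in \<open>{0..2/3}\<close>: the second is negative for \<open>x < 1/2\<close>, the first is at
  least 2 otherwise. So each use of self-similarity halves a bound that is uniform in
  \<open>x\<close>.\<close>

lemma measure_cantor_singleton_le: "measure cantor {x} \<le> (1/2) ^ n"
proof (induction n arbitrary: x)
  case (Suc n)
  have eq: "{y. y/4 \<in> {x}} = {4 * x}" "{y. y/4 + 1/2 \<in> {x}} = {4 * x - 2}"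
    by (auto simp: field_simps)
  have "measure cantor {x} = (measure cantor {4 * x} + measure cantor {4 * x - 2}) / 2"
    by (subst measure_cantor) (simp_all only: eq borel_singleton sets.empty_sets)
  moreover have "measure cantor {4 * x} = 0 \<or> measure cantor {4 * x - 2} = 0"
    using measure_cantor_outside[of "{4 * x}"] measure_cantor_outside[of "{4 * x - 2}"]
    by (cases "x < 1/2") auto
  ultimately show ?case
    using Suc[of "4 * x"] Suc[of "4 * x - 2"] by auto
qed simp

lemma measure_cantor_singleton: "measure cantor {x} = 0"
proof (rule antisym)
  have "(\<lambda>n. (1/2) ^ n) \<longlonglongrightarrow> (0::real)"
    by (rule LIMSEQ_realpow_zero) auto
  then show "measure cantor {x} \<le> 0"
    by (rule LIMSEQ_le_const) (use measure_cantor_singleton_le in auto)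
qed simp

text \<open>Level n of the Cantor construction: 2^n intervals of length (2/3)/4^n. Using the inverse
  branches rather than images makes each level a preimage, so that measurability and scaling are
  immediate.\<close>

primrec cantor_cover :: "nat \<Rightarrow> real set" where
  "cantor_cover 0 = {0..2/3}"
| "cantor_cover (Suc n) = {x. 4 * x \<in> cantor_cover n} \<union> {x. 4 * x - 2 \<in> cantor_cover n}"

lemma cantor_cover_measurable [measurable]: "cantor_cover n \<in> sets borel"
proof (induction n)
  case (Suc n)
  then have [measurable]: "cantor_cover n \<in> sets borel" .
  show ?case
    by simp
qed simp

lemma emeasure_lborel_dilate:
  fixes t :: real
  assumes [measurable]: "A \<in> sets borel"
  shows "emeasure lborel {x. 4 * x + t \<in> A} = emeasure lborel A / 4"
proof -
  have "emeasure lborel A = ennreal \<bar>4\<bar> * (\<integral>\<^sup>+x. indicator A (t + 4 * x) \<partial>lborel)"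
    by (subst nn_integral_real_affine[symmetric]) auto
  also have "(\<integral>\<^sup>+x. indicator A (t + 4 * x) \<partial>lborel) = (\<integral>\<^sup>+x. indicator {x. 4 * x + t \<in> A} x \<partial>lborel)"
    by (intro nn_integral_cong) (auto simp: indicator_def add.commute)
  finally have "emeasure lborel A = emeasure lborel {x. 4 * x + t \<in> A} * 4"
    by (simp add: mult.commute)
  then show ?thesis
    using ennreal_mult_divide_eq[of 4 "emeasure lborel {x. 4 * x + t \<in> A}"] by (simp only:) simp
qed

text \<open>Two copies scaled by 1/4 have together at most half the Lebesgue measure, and the
  initial length 2/3 is below 1.\<close>

lemma emeasure_cantor_cover: "emeasure lborel (cantor_cover n) \<le> ennreal ((1/2) ^ n)"
proof (induction n)
  case 0
  show ?case
    by simp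
next
  case (Suc n)
  have "emeasure lborel (cantor_cover (Suc n))
      \<le> emeasure lborel {x. 4 * x + 0 \<in> cantor_cover n} + emeasure lborel {x. 4 * x + (- 2) \<in> cantor_cover n}"
    by (simp add: emeasure_subadditive)
  also have "\<dots> = emeasure lborel (cantor_cover n) / 4 + emeasure lborel (cantor_cover n) / 4"
    by (simp only: emeasure_lborel_dilate cantor_cover_measurable)
  also have "\<dots> \<le> ennreal ((1/2) ^ n) / 4 + ennreal ((1/2) ^ n) / 4"
    by (intro add_mono divide_right_mono_ennreal Suc)
  also have "\<dots> = ennreal ((1/2) ^ Suc n)"
    by (simp add: divide_ennreal[of _ 4, simplified] ennreal_plus[symmetric] del: ennreal_plus)
  finally show ?case .
qed

text \<open>Both contractions map \<open>cantor_cover n\<close> into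
  \<open>cantor_cover (Suc n)\<close>, so both terms of \<open>measure_cantor\<close> are 1 by
  induction.\<close>

lemma measure_cantor_cover: "measure cantor (cantor_cover n) = 1"
proof (induction n)
  case 0
  show ?case
    using AE_cantor by (simp add: cantor.prob_eq_1)
next
  case (Suc n)
  have "measure cantor (cantor_cover n) \<le> measure cantor {x. x/4 \<in> cantor_cover (Suc n)}"
    "measure cantor (cantor_cover n) \<le> measure cantor {x. x/4 + 1/2 \<in> cantor_cover (Suc n)}"
    by (intro cantor.finite_measure_mono; auto)+
  then have "measure cantor {x. x/4 \<in> cantor_cover (Suc n)} = 1"
    "measure cantor {x. x/4 + 1/2 \<in> cantor_cover (Suc n)} = 1"
    using Suc by (auto intro!: antisym)
  then show ?case
    by (subst measure_cantor) auto
qed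

lemma mutually_singular_cantor: "mutually_singular cantor lborel"
  unfolding mutually_singular_def
proof (intro bexI conjI)
  \<comment> \<open>The witness for \<open>mutually_singular\<close> is \<open>- ?K\<close>: it is
    null for \<open>cantor\<close>, while its complement \<open>?K\<close> is Lebesgue null.\<close>
  let ?K = "\<Inter>n. cantor_cover n"
  have "AE x in cantor. x \<in> cantor_cover n" for n
    using measure_cantor_cover by (simp add: cantor.prob_eq_1[symmetric])
  then have "AE x in cantor. x \<in> ?K"
    by (simp add: AE_all_countable)
  then have "measure cantor ?K = 1"
    by (subst cantor.prob_eq_1) auto
  then show "emeasure cantor (- ?K) = 0"
    using cantor.prob_compl[of ?K] by (simp add: cantor.emeasure_eq_measure Compl_eq_Diff_UNIV)
  have "emeasure lborel ?K \<le> ennreal ((1/2) ^ n)" for n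
    using emeasure_mono[of ?K "cantor_cover n" lborel] emeasure_cantor_cover[of n]
    by (auto intro: order_trans)
  moreover have "(\<lambda>n. ennreal ((1/2) ^ n)) \<longlonglongrightarrow> ennreal 0"
    by (intro tendsto_ennrealI LIMSEQ_realpow_zero) auto
  ultimately have "emeasure lborel ?K \<le> ennreal 0"
    by (intro LIMSEQ_le_const) auto
  then show "emeasure lborel (space lborel - - ?K) = 0"
    by (simp add: Diff_Compl del: Compl_INT)
qed simp

section \<open>The Laplace transform\<close>

definition cantor_laplace :: "complex \<Rightarrow> complex" where
  "cantor_laplace z = (CLINT x|cantor. exp (z * of_real x))"

lemma norm_exp_le_unit: "x \<in> {0..2/3} \<Longrightarrow> cmod (exp (z * of_real x)) \<le> exp (cmod z)"
  by (intro order_trans[OF norm_exp]) (auto simp: norm_mult mult_left_le)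

lemma integrable_cantor_exp:
  fixes z :: complex
  shows "integrable cantor (\<lambda>x. exp (z * of_real x))"
  by (rule integrable_cantor_bounded[OF _ norm_exp_le_unit]) simp_all

lemma cantor_laplace_rec: "cantor_laplace z = (1 + exp (z / 2)) / 2 * cantor_laplace (z / 4)"
proof -
  have "exp (z * of_real (x/4)) = exp (z / 4 * of_real x)"
    "exp (z * of_real (x/4 + 1/2)) = exp (z / 2) * exp (z / 4 * of_real x)" for x
    by (simp_all add: exp_add[symmetric] field_simps)
  then show ?thesis
    unfolding cantor_laplace_def integral_cantor[OF integrable_cantor_exp[of z]]
    by (simp add: scaleR_conv_of_real field_simps)
qed

text \<open>Since \<open>Re z\<close> is not 0, the modulus of exp(z/(2*4^n)) is never 1, and the
  factor 1 + exp(z/(2*4^n)) in the recursion cannot vanish. A zero at \<open>z\<close> would thus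
  pass on to every z/4^n, although the values there tend to the total mass 1.\<close>

lemma cantor_laplace_nonzero:
  assumes "Re z \<noteq> 0"
  shows "cantor_laplace z \<noteq> 0"
proof
  assume zero: "cantor_laplace z = 0"
  have eq0: "cantor_laplace (z / 4 ^ n) = 0" for n
  proof (induction n)
    case (Suc n)
    have "z / 4 ^ n / 2 = z / of_real (4 ^ n * 2)"
      by simp
    then have "Re (z / 4 ^ n / 2) \<noteq> 0"
      using assms by (simp only: Re_divide_of_real) simp
    then have "cmod (exp (z / 4 ^ n / 2)) \<noteq> cmod (- 1)"
      by (simp only: norm_exp_eq_Re) simp
    then have "1 + exp (z / 4 ^ n / 2) \<noteq> 0"
      by (metis add_eq_0_iff2 minus_minus)
    moreover have "(1 + exp (z / 4 ^ n / 2)) / 2 * cantor_laplace (z / 4 ^ n / 4) = 0"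
      using Suc cantor_laplace_rec[of "z / 4 ^ n"] by (simp only:)
    ultimately show ?case
      by (simp add: divide_divide_eq_left mult.commute)
  qed (use zero in simp)
  have "(\<lambda>n. cantor_laplace (z / 4 ^ n)) \<longlonglongrightarrow> (CLINT x|cantor. 1)"
    unfolding cantor_laplace_def
  proof (rule integral_dominated_convergence[of _ _ _ "\<lambda>_. exp (cmod z)"])
    have "(\<lambda>n. (1/4) ^ n) \<longlonglongrightarrow> (0::complex)"
      by (rule LIMSEQ_power_zero) (simp add: norm_divide)
    from tendsto_mult[OF tendsto_const this, of z]
    have lim: "(\<lambda>n. z / 4 ^ n) \<longlonglongrightarrow> 0"
      by (simp add: power_divide)
    have "(\<lambda>n. exp (z / 4 ^ n * of_real x)) \<longlonglongrightarrow> exp (0 * of_real x)" for x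
      by (intro tendsto_intros lim)
    then show "AE x in cantor. (\<lambda>n. exp (z / 4 ^ n * of_real x)) \<longlonglongrightarrow> 1"
      by simp
    show "AE x in cantor. cmod (exp (z / 4 ^ n * of_real x)) \<le> exp (cmod z)" for n
      using AE_cantor
    proof eventually_elim
      case (elim x)
      have "cmod (z / 4 ^ n) = cmod z / 4 ^ n"
        by (simp add: norm_divide norm_power)
      also have "\<dots> \<le> cmod z / 1"
        by (intro divide_left_mono) auto
      finally have "exp (cmod (z / 4 ^ n)) \<le> exp (cmod z)"
        by simp
      then show ?case
        by (rule order_trans[OF norm_exp_le_unit[OF elim]])
    qed
  qed auto
  then show False
    using cantor.prob_space by (simp add: eq0 LIMSEQ_const_iff)
qed

section \<open>Splitting of Fourier coefficients\<close>

lemma cmod_expo [simp]: "cmod (expo t x) = 1"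
  unfolding expo_def by (rule norm_exp_i_times)

lemma expo_measurable [measurable]: "expo t \<in> borel_measurable borel"
  unfolding expo_def by measurable

lemma expo_cis: "expo t x = cis (2 * pi * (t * x))"
  by (simp add: expo_def cis_conv_exp mult_ac)

lemma expo_mult: "expo s x * expo t x = expo (s + t) x"
  by (simp add: expo_cis cis_mult ring_distribs)

lemma expo_quarter: "expo t (x/4) = expo (t/4) x"
  by (simp add: expo_cis)

lemma expo_quarter_shift: "expo t (x/4 + 1/2) = expo (t/2) 1 * expo (t/4) x"
  by (simp add: expo_cis cis_mult ring_distribs add.commute)

lemma expo_Ints: "t \<in> \<int> \<Longrightarrow> expo t 1 = 1"
  by (simp add: expo_cis cis_multiple_2pi)

lemma expo_half: "expo (-1/2) 1 = -1"
  by (simp add: expo_cis complex_eq_iff)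

section \<open>Square-integrable functions\<close>

lemma L2_measurable [measurable_dest]: "f \<in> L2 M \<Longrightarrow> f \<in> borel_measurable M"
  by (simp add: L2_def)

lemma L2_integrable_square: "f \<in> L2 M \<Longrightarrow> integrable M (\<lambda>x. (cmod (f x))\<^sup>2)"
  by (simp add: L2_def)

lemma L2_cantor_measurable: "f \<in> L2 cantor \<Longrightarrow> f \<in> borel_measurable borel"
  using L2_measurable measurable_cong_sets sets_cantor by blast

lemma L2_norm_square: "(L2_norm M f)\<^sup>2 = (LINT x|M. (cmod (f x))\<^sup>2)"
  by (simp add: L2_norm_def)

lemma cmod_add_square_le: "(cmod (a + b))\<^sup>2 \<le> 2 * (cmod a)\<^sup>2 + 2 * (cmod b)\<^sup>2"
proof -
  have "(cmod (a + b))\<^sup>2 \<le> (cmod a + cmod b)\<^sup>2"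
    by (intro power_mono norm_triangle_ineq) auto
  also have "\<dots> \<le> 2 * (cmod a)\<^sup>2 + 2 * (cmod b)\<^sup>2"
    using sum_squares_bound[of "cmod a" "cmod b"] by (simp add: power2_sum)
  finally show ?thesis .
qed

lemma L2_add:
  assumes "f \<in> L2 M" "g \<in> L2 M"
  shows "(\<lambda>x. f x + g x) \<in> L2 M"
proof -
  note [measurable] = L2_measurable[OF assms(1)] L2_measurable[OF assms(2)]
  have "integrable M (\<lambda>x. (cmod (f x + g x))\<^sup>2)"
    by (rule Bochner_Integration.integrable_bound[of _ "\<lambda>x. 2 * (cmod (f x))\<^sup>2 + 2 * (cmod (g x))\<^sup>2"])
       (use assms in \<open>auto simp: L2_integrable_square intro: cmod_add_square_le\<close>)
  then show ?thesis
    by (simp add: L2_def)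
qed

lemma L2_mult_bounded:
  assumes f: "f \<in> L2 M" and [measurable]: "g \<in> borel_measurable M" and "\<And>x. cmod (g x) \<le> B"
  shows "(\<lambda>x. g x * f x) \<in> L2 M"
proof -
  note [measurable] = L2_measurable[OF f]
  have "integrable M (\<lambda>x. (cmod (g x * f x))\<^sup>2)"
  proof (rule Bochner_Integration.integrable_bound)
    show "integrable M (\<lambda>x. B\<^sup>2 * (cmod (f x))\<^sup>2)"
      using f by (simp add: L2_integrable_square)
    show "AE x in M. norm ((cmod (g x * f x))\<^sup>2) \<le> norm (B\<^sup>2 * (cmod (f x))\<^sup>2)"
      using assms(3) by (intro AE_I2) (simp add: norm_mult power_mult_distrib mult_right_mono power_mono)
  qed measurable
  then show ?thesis
    by (simp add: L2_def)
qed

lemma L2_cmult: "f \<in> L2 M \<Longrightarrow> (\<lambda>x. c * f x) \<in> L2 M"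
  by (rule L2_mult_bounded[of _ _ _ "cmod c"]) auto

lemma L2_diff: "f \<in> L2 M \<Longrightarrow> g \<in> L2 M \<Longrightarrow> (\<lambda>x. f x - g x) \<in> L2 M"
  using L2_add[OF _ L2_cmult[of g M "-1"], of f] by simp

lemma (in finite_measure) L2_integrable:
  assumes "f \<in> L2 M"
  shows "integrable M f"
proof (rule Bochner_Integration.integrable_bound)
  show "integrable M (\<lambda>x. 1 + (cmod (f x))\<^sup>2)"
    using assms by (simp add: L2_integrable_square)
  have "t \<le> 1 + t\<^sup>2" if "0 \<le> t" for t :: real
    using sum_squares_bound[of t 1] that by simp
  then show "AE x in M. norm (f x) \<le> norm (1 + (cmod (f x))\<^sup>2)"
    by simp
qed (use assms in \<open>simp add: L2_measurable\<close>)

text \<open>The second inequality says that the variance of the modulus of \<open>f\<close> is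
  nonnegative.\<close>

lemma (in prob_space) cmod_expectation_square_le:
  assumes "f \<in> L2 M"
  shows "(cmod (CLINT x|M. f x))\<^sup>2 \<le> (LINT x|M. (cmod (f x))\<^sup>2)"
proof -
  have "(cmod (CLINT x|M. f x))\<^sup>2 \<le> (LINT x|M. cmod (f x))\<^sup>2"
    by (intro power_mono integral_norm_bound) auto
  also have "\<dots> \<le> (LINT x|M. (cmod (f x))\<^sup>2)"
    using variance_positive[of "\<lambda>x. cmod (f x)"]
      variance_eq[of "\<lambda>x. cmod (f x)"] L2_integrable[OF assms] L2_integrable_square[OF assms]
    by simp
  finally show ?thesis .
qed

section \<open>Even and odd parts of a function\<close>

definition coef :: "(real \<Rightarrow> complex) \<Rightarrow> real \<Rightarrow> complex" where
  "coef f t = (CLINT x|cantor. f x * expo (- t) x)"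

definition even_part :: "(real \<Rightarrow> complex) \<Rightarrow> real \<Rightarrow> complex" where
  "even_part f = (\<lambda>x. (f (x/4) + f (x/4 + 1/2)) / 2)"

text \<open>For integral t, the shift by 1/2 gives \<open>expo (- (4 * t)) x\<close> the phase 1 and
  \<open>expo (- (4 * t + 1)) x\<close> the phase -1, hence the sum in \<open>even_part\<close> and
  the difference here. After rescaling by 4, the frequency 4t + 1 becomes t + 1/4; the modulation
  absorbs the 1/4.\<close>

definition odd_part :: "(real \<Rightarrow> complex) \<Rightarrow> real \<Rightarrow> complex" where
  "odd_part f = (\<lambda>x. expo (- 1/4) x * ((f (x/4) - f (x/4 + 1/2)) / 2))"

lemma L2_cantor_halves:
  assumes "f \<in> L2 cantor"
  shows "(\<lambda>x. f (x/4)) \<in> L2 cantor" "(\<lambda>x. f (x/4 + 1/2)) \<in> L2 cantor"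
proof -
  note [measurable] = L2_cantor_measurable[OF assms]
  show "(\<lambda>x. f (x/4)) \<in> L2 cantor" "(\<lambda>x. f (x/4 + 1/2)) \<in> L2 cantor"
    using integrable_cantor_halves[OF L2_integrable_square[OF assms]] by (simp_all add: L2_def)
qed

lemma L2_expo_mult: "f \<in> L2 cantor \<Longrightarrow> (\<lambda>x. expo t x * f x) \<in> L2 cantor"
  by (rule L2_mult_bounded[of _ _ _ 1]) auto

lemma L2_parts:
  assumes "f \<in> L2 cantor"
  shows "even_part f \<in> L2 cantor" "odd_part f \<in> L2 cantor"
proof -
  note h = L2_cantor_halves[OF assms]
  show "even_part f \<in> L2 cantor"
    using L2_cmult[OF L2_add[OF h], of "1/2"] by (simp add: even_part_def)
  show "odd_part f \<in> L2 cantor"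
    using L2_expo_mult[OF L2_cmult[OF L2_diff[OF h], of "1/2"]] by (simp add: odd_part_def)
qed

lemma integrable_coef: "f \<in> L2 cantor \<Longrightarrow> integrable cantor (\<lambda>x. f x * expo t x)"
  using cantor.L2_integrable[OF L2_expo_mult] by (simp add: mult.commute)

lemma coef_split:
  assumes "f \<in> L2 cantor"
  shows "coef f t = (CLINT x|cantor. (f (x/4) * expo (- t/4) x
    + f (x/4 + 1/2) * (expo (- t/2) 1 * expo (- t/4) x)) / 2)"
proof -
  note int = integrable_coef[OF assms, of "- t"]
  show ?thesis
    using integrable_cantor_halves[OF int]
    unfolding coef_def integral_cantor[OF int] expo_quarter expo_quarter_shift
    by (simp add: scaleR_conv_of_real)
qed

lemma coef_even:
  assumes "f \<in> L2 cantor" and "t \<in> \<int>"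
  shows "coef f (4 * t) = coef (even_part f) t"
proof -
  have *: "expo (- (4 * t) / 2) 1 = 1"
    using assms(2) by (intro expo_Ints) auto
  show ?thesis
    unfolding coef_split[OF assms(1)] coef_def[of "even_part f"] *
    by (intro Bochner_Integration.integral_cong refl) (simp add: even_part_def field_simps)
qed

lemma coef_odd:
  assumes "f \<in> L2 cantor" and "t \<in> \<int>"
  shows "coef f (4 * t + 1) = coef (odd_part f) t"
proof -
  have "expo (- (4 * t + 1) / 2) 1 = expo (- (2 * t)) 1 * expo (-1/2) 1"
    by (simp add: expo_mult diff_divide_distrib)
  also have "expo (- (2 * t)) 1 = 1"
    using assms(2) by (intro expo_Ints) auto
  finally have *: "expo (- (4 * t + 1) / 2) 1 = - 1"
    using expo_half by simp
  have **: "expo (- (4 * t + 1) / 4) x = expo (-1/4) x * expo (- t) x" for x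
    unfolding expo_mult by (intro arg_cong[where f = "\<lambda>s. expo s x"]) simp
  show ?thesis
    unfolding coef_split[OF assms(1)] coef_def[of "odd_part f"] * **
    by (intro Bochner_Integration.integral_cong refl) (simp add: odd_part_def field_simps)
qed

lemma parallelogram_half:
  "(cmod ((a + b) / 2))\<^sup>2 + (cmod ((a - b) / 2))\<^sup>2 = ((cmod a)\<^sup>2 + (cmod b)\<^sup>2) / 2"
  by (simp add: cmod_power2 power2_sum power2_diff add_divide_distrib diff_divide_distrib power_divide)

text \<open>The modulation in \<open>odd_part\<close> has modulus 1, so the parallelogram law holds
  pointwise for the two parts; self-similarity applied to the square of the modulus of
  \<open>f\<close> then gives the norm of \<open>f\<close>.\<close>

lemma L2_norm_parts:
  assumes "f \<in> L2 cantor"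
  shows "(L2_norm cantor f)\<^sup>2 = (L2_norm cantor (even_part f))\<^sup>2 + (L2_norm cantor (odd_part f))\<^sup>2"
proof -
  have "(L2_norm cantor (even_part f))\<^sup>2 + (L2_norm cantor (odd_part f))\<^sup>2
      = (LINT x|cantor. (cmod (even_part f x))\<^sup>2 + (cmod (odd_part f x))\<^sup>2)"
    using L2_parts[OF assms] by (simp add: L2_norm_square L2_integrable_square)
  also have "\<dots> = (LINT x|cantor. ((cmod (f (x/4)))\<^sup>2 + (cmod (f (x/4 + 1/2)))\<^sup>2) / 2)"
    by (simp add: even_part_def odd_part_def norm_mult parallelogram_half flip: parallelogram_half)
  also have "\<dots> = (L2_norm cantor f)\<^sup>2"
    using L2_cantor_halves[OF assms, THEN L2_integrable_square] L2_integrable_square[OF assms]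
    by (simp add: L2_norm_square integral_cantor)
  finally show ?thesis ..
qed

text \<open>Integers with at most n base-4 digits, all of them 0 or 1. The recursion adds the lowest
  digit because \<open>coef_even\<close> and \<open>coef_odd\<close> sort the frequencies by that
  digit.\<close>

primrec freqs :: "nat \<Rightarrow> real set" where
  "freqs 0 = {0}"
| "freqs (Suc n) = (\<lambda>t. 4 * t) ` freqs n \<union> (\<lambda>t. 4 * t + 1) ` freqs n"

lemma finite_freqs: "finite (freqs n)"
  by (induction n) auto

lemma freqs_Ints: "freqs n \<subseteq> \<int>"
  by (induction n) auto

lemma freqs_Suc: "freqs n \<subseteq> freqs (Suc n)"
  by (induction n) auto

lemma freqs_mono: "m \<le> n \<Longrightarrow> freqs m \<subseteq> freqs n"
  by (rule lift_Suc_mono_le[of freqs]) (rule freqs_Suc)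

definition energy :: "real set \<Rightarrow> (real \<Rightarrow> complex) \<Rightarrow> real" where
  "energy T f = (\<Sum>t\<in>T. (cmod (coef f t))\<^sup>2)"

text \<open>The frequencies are integers, so 4s and 4t + 1 never coincide and the sum splits over
  the two images; \<open>coef_even\<close> and \<open>coef_odd\<close> then remove the lowest
  digit.\<close>

lemma energy_Suc:
  assumes "f \<in> L2 cantor"
  shows "energy (freqs (Suc n)) f = energy (freqs n) (even_part f) + energy (freqs n) (odd_part f)"
proof -
  have disj: "(\<lambda>t. 4 * t) ` freqs n \<inter> (\<lambda>t. 4 * t + 1) ` freqs n = {}"
  proof -
    have False if "s \<in> freqs n" "t \<in> freqs n" "4 * s = 4 * t + 1" for s t
    proof -
      from that freqs_Ints obtain i j where "s = of_int i" "t = of_int j"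
        by (meson Ints_cases subsetD)
      with that(3) have "real_of_int (4 * i) = of_int (4 * j + 1)"
        by simp
      then have "4 * i = 4 * j + 1"
        by (simp only: of_int_eq_iff)
      then show False
        by presburger
    qed
    then show ?thesis
      by auto
  qed
  have "energy (freqs (Suc n)) f
      = (\<Sum>t\<in>freqs n. (cmod (coef f (4 * t)))\<^sup>2) + (\<Sum>t\<in>freqs n. (cmod (coef f (4 * t + 1)))\<^sup>2)"
    unfolding energy_def freqs.simps
    by (subst sum.union_disjoint) (auto simp: finite_freqs disj sum.reindex inj_on_def)
  also have "\<dots> = energy (freqs n) (even_part f) + energy (freqs n) (odd_part f)"
    unfolding energy_def using freqs_Ints[of n]
    by (intro arg_cong2[where f = "(+)"] sum.cong refl) (auto simp: coef_even coef_odd assms)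
  finally show ?thesis .
qed

text \<open>Bessel's inequality without any appeal to orthogonality: both sides split in the same
  way into even and odd part, which leaves only the frequency 0, where
  \<open>cmod_expectation_square_le\<close> applies.\<close>

lemma energy_le: "f \<in> L2 cantor \<Longrightarrow> energy (freqs n) f \<le> (L2_norm cantor f)\<^sup>2"
proof (induction n arbitrary: f)
  case 0
  then show ?case
    using cantor.cmod_expectation_square_le[OF 0] by (simp add: energy_def coef_def L2_norm_square expo_def)
next
  case (Suc n)
  show ?case
    unfolding energy_Suc[OF Suc.prems] L2_norm_parts[OF Suc.prems]
    by (intro add_mono Suc.IH L2_parts Suc.prems)
qed

text \<open>Constancy on each of the 2^n cylinders of level n. Nothing is required off the
  cylinders, not even measurability, so membership in \<open>L2 cantor\<close> is always stated
  separately.\<close>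

primrec step_fun :: "nat \<Rightarrow> (real \<Rightarrow> complex) \<Rightarrow> bool" where
  "step_fun 0 h \<longleftrightarrow> (\<exists>c. \<forall>x\<in>{0..2/3}. h x = c)"
| "step_fun (Suc n) h \<longleftrightarrow> step_fun n (\<lambda>x. h (x/4)) \<and> step_fun n (\<lambda>x. h (x/4 + 1/2))"

lemma step_fun_lincomb:
  "step_fun n f \<Longrightarrow> step_fun n g \<Longrightarrow> step_fun n (\<lambda>x. a * f x + b * g x)"
proof (induction n arbitrary: f g)
  case 0
  then obtain c d where "\<forall>x\<in>{0..2/3}. f x = c" "\<forall>x\<in>{0..2/3}. g x = d"
    by auto
  then show ?case
    by (auto intro!: exI[of _ "a * c + b * d"])
qed auto

lemma step_fun_Suc: "step_fun n h \<Longrightarrow> step_fun (Suc n) h"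
proof (induction n arbitrary: h)
  case 0
  then obtain c where "\<forall>x\<in>{0..2/3}. h x = c"
    by auto
  then show ?case
    by (auto intro!: exI[of _ c])
next
  case (Suc n)
  then have "step_fun (Suc n) (\<lambda>x. h (x/4))" "step_fun (Suc n) (\<lambda>x. h (x/4 + 1/2))"
    by (simp_all only: step_fun.simps(2)[of n h])
  then show ?case
    by (simp only: step_fun.simps(2)[of "Suc n" h])
qed

lemma step_fun_mono: "m \<le> n \<Longrightarrow> step_fun m h \<Longrightarrow> step_fun n h"
  by (induction rule: dec_induct) (auto intro: step_fun_Suc simp del: step_fun.simps)

text \<open>For x in \<open>{0..2/3}\<close> the angle 2 pi t x is at most 2 pi * (1/3) * (2/3) = 4
  pi / 9, which is below pi / 2. The real part of the integrand is therefore bounded below by a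
  positive constant.\<close>

lemma cmod_coef_one_ge:
  assumes "t \<in> {0..1/3}"
  shows "cos (4 * pi / 9) \<le> cmod (CLINT x|cantor. expo (- t) x)"
proof -
  have int: "integrable cantor (expo (- t))"
    by (rule integrable_cantor_bounded[of _ 1]) auto
  have "(LINT x|cantor. cos (4 * pi / 9)) \<le> (LINT x|cantor. Re (expo (- t) x))"
  proof (rule integral_mono_AE)
    show "AE x in cantor. cos (4 * pi / 9) \<le> Re (expo (- t) x)"
      using AE_cantor
    proof eventually_elim
      case (elim x)
      have "t * x \<le> (1/3) * (2/3)"
        using elim assms by (intro mult_mono) auto
      then have "2 * pi * (t * x) \<le> 2 * pi * (2/9)"
        by (intro mult_left_mono) auto
      moreover have "0 \<le> 2 * pi * (t * x)"
        using elim assms by auto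
      ultimately have "cos (4 * pi / 9) \<le> cos (2 * pi * (t * x))"
        by (intro cos_monotone_0_pi_le) auto
      then show ?case
        by (simp add: expo_def Re_exp mult.assoc)
    qed
  qed (use int in auto)
  also have "\<dots> = Re (CLINT x|cantor. expo (- t) x)"
    using int by simp
  also have "\<dots> \<le> cmod (CLINT x|cantor. expo (- t) x)"
    by (rule complex_Re_le_cmod)
  finally show ?thesis
    using cantor.prob_space by simp
qed

text \<open>The modulation by \<open>t\<close> is there for the induction: the even and odd parts of
  a modulated step function are step functions of the level below, modulated by t/4 and (t + 1)/4.
  Both maps send \<open>{0..1/3}\<close> to itself, with 1/3 the fixed point of the second, so the
  same constant serves at all levels.\<close>

lemma energy_step_fun_ge:
  assumes "step_fun n h" and "h \<in> L2 cantor" and "t \<in> {0..1/3}"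
  shows "(cos (4 * pi / 9))\<^sup>2 * (L2_norm cantor (\<lambda>x. expo (- t) x * h x))\<^sup>2
    \<le> energy (freqs n) (\<lambda>x. expo (- t) x * h x)"
  using assms
proof (induction n arbitrary: h t)
  case 0
  then obtain c where c: "\<And>x. x \<in> {0..2/3} \<Longrightarrow> h x = c"
    by auto
  note [measurable] = L2_cantor_measurable[OF 0(2)]
  have "(L2_norm cantor (\<lambda>x. expo (- t) x * h x))\<^sup>2 = (LINT x|cantor. (cmod c)\<^sup>2)"
    unfolding L2_norm_square
  proof (rule integral_cong_AE)
    show "AE x in cantor. (cmod (expo (- t) x * h x))\<^sup>2 = (cmod c)\<^sup>2"
      using AE_cantor by eventually_elim (simp add: norm_mult c)
  qed auto
  moreover have "coef (\<lambda>x. expo (- t) x * h x) 0 = (CLINT x|cantor. expo (- t) x * c)"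
    unfolding coef_def
  proof (rule integral_cong_AE)
    show "AE x in cantor. expo (- t) x * h x * expo (- 0) x = expo (- t) x * c"
      using AE_cantor by eventually_elim (simp add: c, simp add: expo_def)
  qed auto
  moreover have "(cos (4 * pi / 9))\<^sup>2 \<le> (cmod (CLINT x|cantor. expo (- t) x))\<^sup>2"
    by (intro power_mono cmod_coef_one_ge 0 cos_ge_zero) (auto intro: order_trans[of _ 0])
  ultimately show ?case
    using cantor.prob_space by (simp add: energy_def norm_mult power_mult_distrib mult_right_mono)
next
  case (Suc n)
  let ?f = "\<lambda>x. expo (- t) x * h x"
  \<comment> \<open>The phase that the modulation acquires from the shift by 1/2. Being constant, it
    goes into the coefficients of the step functions \<open>?e\<close> and
    \<open>?o\<close>.\<close>
  let ?c = "expo (- t / 2) 1"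
  let ?e = "\<lambda>x. 1/2 * h (x/4) + (?c/2) * h (x/4 + 1/2)"
  let ?o = "\<lambda>x. 1/2 * h (x/4) + (- ?c/2) * h (x/4 + 1/2)"
  note halves = L2_cantor_halves[OF Suc.prems(2)]
  have comb: "step_fun n (\<lambda>x. a * h (x/4) + b * h (x/4 + 1/2))"
    "(\<lambda>x. a * h (x/4) + b * h (x/4 + 1/2)) \<in> L2 cantor" for a b
    using Suc.prems(1) L2_add[OF halves[THEN L2_cmult]] by (simp_all add: step_fun_lincomb)
  have e: "even_part ?f = (\<lambda>x. expo (- (t/4)) x * ?e x)"
    unfolding even_part_def expo_quarter expo_quarter_shift
    by (rule ext) (simp add: ring_distribs add_divide_distrib)
  have "odd_part ?f = (\<lambda>x. (expo (- 1/4) x * expo (- t/4) x) * ?o x)"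
    unfolding odd_part_def expo_quarter expo_quarter_shift
    by (rule ext) (simp add: ring_distribs diff_divide_distrib mult_ac)
  moreover have "- 1/4 + - t/4 = - ((t + 1)/4)"
    by (simp add: field_simps)
  ultimately have o: "odd_part ?f = (\<lambda>x. expo (- ((t + 1)/4)) x * ?o x)"
    by (simp only: expo_mult)
  have "(cos (4 * pi / 9))\<^sup>2 * (L2_norm cantor (even_part ?f))\<^sup>2 \<le> energy (freqs n) (even_part ?f)"
    unfolding e
    by (rule Suc.IH[OF comb]) (use Suc.prems(3) in simp)
  moreover have "(cos (4 * pi / 9))\<^sup>2 * (L2_norm cantor (odd_part ?f))\<^sup>2 \<le> energy (freqs n) (odd_part ?f)"
    unfolding o
    by (rule Suc.IH[OF comb]) (use Suc.prems(3) in simp)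
  moreover have "?f \<in> L2 cantor"
    using Suc.prems(2) by (rule L2_expo_mult)
  ultimately show ?case
    by (simp only: energy_Suc L2_norm_parts ring_distribs add_mono)
qed

section \<open>Density of step functions and the frame inequality\<close>

lemma L2_norm_cong_cantor:
  assumes "f \<in> borel_measurable borel" "g \<in> borel_measurable borel"
    and "\<And>x. x \<in> {0..2/3} \<Longrightarrow> f x = g x"
  shows "L2_norm cantor f = L2_norm cantor g"
proof -
  have "(LINT x|cantor. (cmod (f x))\<^sup>2) = (LINT x|cantor. (cmod (g x))\<^sup>2)"
  proof (rule integral_cong_AE)
    show "AE x in cantor. (cmod (f x))\<^sup>2 = (cmod (g x))\<^sup>2"
      using AE_cantor by eventually_elim (simp add: assms(3))
  qed (use assms in auto)
  then show ?thesis
    by (simp add: L2_norm_def)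
qed

lemma L2_norm_add_square_le:
  assumes "f \<in> L2 M" "g \<in> L2 M"
  shows "(L2_norm M (\<lambda>x. f x + g x))\<^sup>2 \<le> 2 * (L2_norm M f)\<^sup>2 + 2 * (L2_norm M g)\<^sup>2"
proof -
  have "(LINT x|M. (cmod (f x + g x))\<^sup>2) \<le> (LINT x|M. 2 * (cmod (f x))\<^sup>2 + 2 * (cmod (g x))\<^sup>2)"
    by (intro integral_mono cmod_add_square_le)
       (use assms L2_add[OF assms] in \<open>auto simp: L2_integrable_square\<close>)
  then show ?thesis
    using assms by (simp add: L2_norm_square L2_integrable_square)
qed

lemma L2_norm_cmult_square: "(L2_norm M (\<lambda>x. c * f x))\<^sup>2 = (cmod c)\<^sup>2 * (L2_norm M f)\<^sup>2"
  by (simp add: L2_norm_square norm_mult power_mult_distrib)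

lemma L2_cantor_bounded:
  assumes [measurable]: "f \<in> borel_measurable borel" and "\<And>x. x \<in> {0..2/3} \<Longrightarrow> cmod (f x) \<le> B"
  shows "f \<in> L2 cantor"
proof -
  have "integrable cantor (\<lambda>x. (cmod (f x))\<^sup>2)"
    by (rule integrable_cantor_bounded[of _ "B\<^sup>2"]) (auto intro!: power_mono assms(2))
  then show ?thesis
    by (simp add: L2_def)
qed

text \<open>Errors are measured by squared norms, so that \<open>L2_norm_add_square_le\<close> can
  stand in for the triangle inequality.\<close>

definition step_approximable :: "(real \<Rightarrow> complex) \<Rightarrow> bool" where
  "step_approximable f \<longleftrightarrow> f \<in> L2 cantor \<and>
     (\<forall>\<epsilon>>0. \<exists>n h. step_fun n h \<and> h \<in> L2 cantor \<and> (L2_norm cantor (\<lambda>x. f x - h x))\<^sup>2 < \<epsilon>)"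

lemma step_approximable_L2: "step_approximable f \<Longrightarrow> f \<in> L2 cantor"
  by (simp add: step_approximable_def)

lemma step_approximableE:
  assumes "step_approximable f" and "0 < \<epsilon>"
  obtains n h where "step_fun n h" "h \<in> L2 cantor" "(L2_norm cantor (\<lambda>x. f x - h x))\<^sup>2 < \<epsilon>"
  using assms unfolding step_approximable_def by blast

lemma step_approximable_add:
  assumes f: "step_approximable f" and g: "step_approximable g"
  shows "step_approximable (\<lambda>x. f x + g x)"
  unfolding step_approximable_def
proof (intro conjI allI impI)
  note fL = step_approximable_L2[OF f] and gL = step_approximable_L2[OF g]
  show "(\<lambda>x. f x + g x) \<in> L2 cantor"
    by (rule L2_add[OF fL gL])
  fix \<epsilon> :: real assume "0 < \<epsilon>"
  \<comment> \<open>Two squared errors below \<epsilon> / 4, each doubled by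
    \<open>L2_norm_add_square_le\<close>, add up to less than \<epsilon>.\<close>
  then have \<epsilon>: "0 < \<epsilon> / 4"
    by simp
  obtain m h where h: "step_fun m h" "h \<in> L2 cantor" "(L2_norm cantor (\<lambda>x. f x - h x))\<^sup>2 < \<epsilon> / 4"
    using step_approximableE[OF f \<epsilon>] .
  obtain n k where k: "step_fun n k" "k \<in> L2 cantor" "(L2_norm cantor (\<lambda>x. g x - k x))\<^sup>2 < \<epsilon> / 4"
    using step_approximableE[OF g \<epsilon>] .
  have "step_fun (max m n) (\<lambda>x. h x + k x)"
    using step_fun_lincomb[OF step_fun_mono[OF _ h(1)] step_fun_mono[OF _ k(1)], of "max m n" 1 1]
    by simp
  moreover have "(L2_norm cantor (\<lambda>x. (f x + g x) - (h x + k x)))\<^sup>2 < \<epsilon>"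
    using L2_norm_add_square_le[OF L2_diff[OF fL h(2)] L2_diff[OF gL k(2)]] h(3) k(3)
    by (simp add: algebra_simps)
  ultimately show "\<exists>n h'. step_fun n h' \<and> h' \<in> L2 cantor \<and>
      (L2_norm cantor (\<lambda>x. (f x + g x) - h' x))\<^sup>2 < \<epsilon>"
    using L2_add[OF h(2) k(2)] by blast
qed

lemma step_approximable_cmult:
  assumes f: "step_approximable f"
  shows "step_approximable (\<lambda>x. c * f x)"
  unfolding step_approximable_def
proof (intro conjI allI impI)
  note fL = step_approximable_L2[OF f]
  show "(\<lambda>x. c * f x) \<in> L2 cantor"
    by (rule L2_cmult[OF fL])
  fix \<epsilon> :: real assume "0 < \<epsilon>"
  \<comment> \<open>The summand 1 keeps the denominator positive when \<open>c\<close> is 0.\<close>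
  have pos: "0 < (cmod c)\<^sup>2 + 1"
    by (simp add: add_nonneg_pos)
  obtain n h where h: "step_fun n h" "h \<in> L2 cantor"
    "(L2_norm cantor (\<lambda>x. f x - h x))\<^sup>2 < \<epsilon> / ((cmod c)\<^sup>2 + 1)"
    using step_approximableE[OF f divide_pos_pos[OF \<open>0 < \<epsilon>\<close> pos]] .
  have "(L2_norm cantor (\<lambda>x. c * f x - c * h x))\<^sup>2 = (cmod c)\<^sup>2 * (L2_norm cantor (\<lambda>x. f x - h x))\<^sup>2"
    by (subst L2_norm_cmult_square[symmetric]) (simp add: right_diff_distrib)
  also have "\<dots> \<le> ((cmod c)\<^sup>2 + 1) * (L2_norm cantor (\<lambda>x. f x - h x))\<^sup>2"
    by (intro mult_right_mono) auto
  also have "\<dots> < \<epsilon>"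
    using h(3) pos by (simp add: pos_less_divide_eq mult.commute)
  finally show "\<exists>n h'. step_fun n h' \<and> h' \<in> L2 cantor \<and> (L2_norm cantor (\<lambda>x. c * f x - h' x))\<^sup>2 < \<epsilon>"
    using step_fun_lincomb[OF h(1) h(1), of c 0] L2_cmult[OF h(2), of c] by auto
qed

text \<open>Dominated convergence turns the pointwise limit into convergence in norm; a step
  function close to some \<open>g i\<close> far out in the sequence is then close to
  \<open>f\<close>.\<close>

lemma step_approximable_dominated_limit:
  assumes g: "\<And>i. step_approximable (g i)" and f: "f \<in> L2 cantor"
    and lim: "\<And>x. (\<lambda>i. g i x) \<longlonglongrightarrow> f x"
    and w: "integrable cantor (\<lambda>x. (w x)\<^sup>2)" "\<And>i x. cmod (f x - g i x) \<le> w x"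
  shows "step_approximable f"
  unfolding step_approximable_def
proof (intro conjI allI impI f)
  fix \<epsilon> :: real assume "0 < \<epsilon>"
  note gL = step_approximable_L2[OF g]
  note [measurable] = L2_measurable[OF f] L2_measurable[OF gL]
  have "(\<lambda>i. LINT x|cantor. (cmod (f x - g i x))\<^sup>2) \<longlonglongrightarrow> (LINT x|cantor. 0)"
  proof (rule integral_dominated_convergence[OF _ _ w(1)])
    have "(\<lambda>i. (cmod (f x - g i x))\<^sup>2) \<longlonglongrightarrow> (cmod (f x - f x))\<^sup>2" for x
      by (intro tendsto_intros lim)
    then show "AE x in cantor. (\<lambda>i. (cmod (f x - g i x))\<^sup>2) \<longlonglongrightarrow> 0"
      by simp
    show "AE x in cantor. norm ((cmod (f x - g i x))\<^sup>2) \<le> (w x)\<^sup>2" for i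
      by (intro AE_I2) (auto intro!: power_mono w(2))
  qed auto
  then have "(\<lambda>i. (L2_norm cantor (\<lambda>x. f x - g i x))\<^sup>2) \<longlonglongrightarrow> 0"
    by (simp add: L2_norm_square)
  then have "\<forall>\<^sub>F i in sequentially. (L2_norm cantor (\<lambda>x. f x - g i x))\<^sup>2 < \<epsilon> / 4"
    by (rule order_tendstoD) (use \<open>0 < \<epsilon>\<close> in simp)
  then obtain i where i: "(L2_norm cantor (\<lambda>x. f x - g i x))\<^sup>2 < \<epsilon> / 4"
    by (auto simp: eventually_sequentially)
  obtain n h where h: "step_fun n h" "h \<in> L2 cantor" "(L2_norm cantor (\<lambda>x. g i x - h x))\<^sup>2 < \<epsilon> / 4"
    using step_approximableE[OF g, of "\<epsilon> / 4"] \<open>0 < \<epsilon>\<close> by auto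
  have "(L2_norm cantor (\<lambda>x. f x - h x))\<^sup>2 < \<epsilon>"
    using L2_norm_add_square_le[OF L2_diff[OF f gL[of i]] L2_diff[OF gL[of i] h(2)]] i h(3)
    by simp
  with h show "\<exists>n h. step_fun n h \<and> h \<in> L2 cantor \<and> (L2_norm cantor (\<lambda>x. f x - h x))\<^sup>2 < \<epsilon>"
    by blast
qed

lemma step_fun_cong:
  "(\<And>x. x \<in> {0..2/3} \<Longrightarrow> f x = g x) \<Longrightarrow> step_fun n f \<Longrightarrow> step_fun n g"
proof (induction n arbitrary: f g)
  case (Suc n)
  have "step_fun n (\<lambda>x. g (x/4))"
    by (rule Suc.IH[of "\<lambda>x. f (x/4)"]) (use Suc.prems in auto)
  moreover have "step_fun n (\<lambda>x. g (x/4 + 1/2))"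
    by (rule Suc.IH[of "\<lambda>x. f (x/4 + 1/2)"]) (use Suc.prems in auto)
  ultimately show ?case
    by simp
qed auto

lemma step_fun_const: "step_fun n (\<lambda>x. c)"
  by (rule step_fun_mono[of 0]) auto

text \<open>The threshold \<open>1/3\<close> separates the two first-level pieces \<open>{0..1/6}\<close> and \<open>{1/2..2/3}\<close>.\<close>

definition glue :: "(real \<Rightarrow> complex) \<Rightarrow> (real \<Rightarrow> complex) \<Rightarrow> real \<Rightarrow> complex" where
  "glue g h x = (if x < 1/3 then g (4 * x) else h (4 * x - 2))"

lemma glue_halves:
  assumes "x \<in> {0..2/3}"
  shows "glue g h (x/4) = g x" "glue g h (x/4 + 1/2) = h x"
  using assms by (auto simp: glue_def field_simps)

lemma step_fun_glue:
  assumes "step_fun n g" "step_fun n h"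
  shows "step_fun (Suc n) (glue g h)"
  using step_fun_cong[OF _ assms(1), of "\<lambda>x. glue g h (x/4)"]
    step_fun_cong[OF _ assms(2), of "\<lambda>x. glue g h (x/4 + 1/2)"]
  by (simp add: glue_halves)

lemma L2_norm_halves:
  assumes "f \<in> L2 cantor"
  shows "(L2_norm cantor f)\<^sup>2 =
    ((L2_norm cantor (\<lambda>x. f (x/4)))\<^sup>2 + (L2_norm cantor (\<lambda>x. f (x/4 + 1/2)))\<^sup>2) / 2"
  using integral_cantor[OF L2_integrable_square[OF assms]] by (simp add: L2_norm_square)

text \<open>The threshold \<open>a\<close> cuts at most one of the two first-level pieces. On the
  other piece the indicator is constant, 0 on the right one if \<open>a < 1/2\<close> and 1 on the
  left one otherwise, and contributes no error; averaging over the pieces halves the squared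
  error.\<close>

lemma step_fun_approx_atMost:
  "\<exists>h. step_fun n h \<and> h \<in> borel_measurable borel \<and> (\<forall>x. cmod (h x) \<le> 1) \<and>
     (L2_norm cantor (\<lambda>x. indicator {..a} x - h x))\<^sup>2 \<le> (1/2) ^ n"
proof (induction n arbitrary: a)
  case 0
  have "(L2_norm cantor (indicator {..a} :: real \<Rightarrow> complex))\<^sup>2 = (LINT x|cantor. indicat_real {..a} x)"
    unfolding L2_norm_square by (intro Bochner_Integration.integral_cong) (auto simp: indicator_def)
  then show ?case
    by (intro exI[of _ "\<lambda>_. 0"]) simp
next
  case (Suc n)
  \<comment> \<open>Approximants \<open>g\<close> and \<open>h\<close> of the two rescaled halves
    are glued together; by \<open>L2_norm_halves\<close> their squared errors are averaged.\<close>
  have main: ?case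
    if "step_fun n g" "step_fun n h" and [measurable]: "g \<in> borel_measurable borel" "h \<in> borel_measurable borel"
      and bound: "\<forall>x. cmod (g x) \<le> 1" "\<forall>x. cmod (h x) \<le> 1"
      and le: "(L2_norm cantor (\<lambda>x. indicator {..4 * a} x - g x))\<^sup>2 +
        (L2_norm cantor (\<lambda>x. indicator {..4 * a - 2} x - h x))\<^sup>2 \<le> (1/2) ^ n"
    for g h
  proof (intro exI conjI)
    show "step_fun (Suc n) (glue g h)"
      using that by (intro step_fun_glue)
    show [measurable]: "glue g h \<in> borel_measurable borel"
      unfolding glue_def [abs_def] by measurable
    show glue_bound: "\<forall>x. cmod (glue g h x) \<le> 1"
      using bound by (simp add: glue_def)
    let ?d = "\<lambda>x. indicator {..a} x - glue g h x"
    have shift: "x/4 + 1/2 \<le> a \<longleftrightarrow> x \<le> 4 * a - 2" for x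
      by auto
    have "?d \<in> L2 cantor"
      by (rule L2_diff; rule L2_cantor_bounded[of _ 1]) (use glue_bound in \<open>auto simp: indicator_def\<close>)
    moreover have "L2_norm cantor (\<lambda>x. ?d (x/4)) = L2_norm cantor (\<lambda>x. indicator {..4 * a} x - g x)"
      by (rule L2_norm_cong_cantor) (auto simp: glue_halves indicator_def)
    moreover have "L2_norm cantor (\<lambda>x. ?d (x/4 + 1/2)) = L2_norm cantor (\<lambda>x. indicator {..4 * a - 2} x - h x)"
      by (rule L2_norm_cong_cantor) (auto simp: glue_halves indicator_def shift)
    ultimately show "(L2_norm cantor ?d)\<^sup>2 \<le> (1/2) ^ Suc n"
      using le by (simp add: L2_norm_halves)
  qed
  show ?case
  proof (cases "a < 1/2")
    case True
    obtain g where "step_fun n g" "g \<in> borel_measurable borel" "\<forall>x. cmod (g x) \<le> 1"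
      "(L2_norm cantor (\<lambda>x. indicator {..4 * a} x - g x))\<^sup>2 \<le> (1/2) ^ n"
      using Suc[of "4 * a"] by blast
    moreover have "L2_norm cantor (\<lambda>x. indicator {..4 * a - 2} x - 0) = L2_norm cantor (\<lambda>x. 0)"
      by (rule L2_norm_cong_cantor) (use True in \<open>auto simp: indicator_def\<close>)
    ultimately show ?thesis
      using main[of g "\<lambda>_. 0"] by (simp add: step_fun_const L2_norm_def)
  next
    case False
    obtain h where "step_fun n h" "h \<in> borel_measurable borel" "\<forall>x. cmod (h x) \<le> 1"
      "(L2_norm cantor (\<lambda>x. indicator {..4 * a - 2} x - h x))\<^sup>2 \<le> (1/2) ^ n"
      using Suc[of "4 * a - 2"] by blast
    moreover have "L2_norm cantor (\<lambda>x. indicator {..4 * a} x - 1) = L2_norm cantor (\<lambda>x. 0)"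
      by (rule L2_norm_cong_cantor) (use False in \<open>auto simp: indicator_def\<close>)
    ultimately show ?thesis
      using main[of "\<lambda>_. 1" h] by (simp add: step_fun_const L2_norm_def)
  qed
qed

lemma step_approximable_const: "step_approximable (\<lambda>x. c)"
  unfolding step_approximable_def
  by (auto intro!: exI[of _ 0] exI[of _ "\<lambda>x. c"] L2_cantor_bounded[of _ "cmod c"] simp: L2_norm_def)

lemma step_approximable_sum:
  "finite I \<Longrightarrow> (\<And>i. i \<in> I \<Longrightarrow> step_approximable (f i)) \<Longrightarrow> step_approximable (\<lambda>x. \<Sum>i\<in>I. f i x)"
  by (induction I rule: finite_induct) (auto intro: step_approximable_const step_approximable_add)

text \<open>Dynkin's argument, starting from the intersection-stable half-lines that generate the
  Borel sets. For a disjoint union the partial sums are again indicators, so 1 dominates the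
  differences.\<close>

lemma step_approximable_indicator:
  assumes "A \<in> sets borel"
  shows "step_approximable (indicator A)"
proof -
  have L2: "indicator B \<in> L2 cantor" if "B \<in> sets borel" for B :: "real set"
    by (rule L2_cantor_bounded[of _ 1]) (use that in \<open>auto simp: indicator_def\<close>)
  have sets: "sets borel = sigma_sets UNIV (range (atMost :: real \<Rightarrow> _))"
    by (simp add: borel_eq_atMost)
  have "Int_stable (range (atMost :: real \<Rightarrow> _))" "range (atMost :: real \<Rightarrow> _) \<subseteq> Pow UNIV"
    by (auto simp: Int_stable_def)
  then show ?thesis
    using assms[unfolded sets]
  proof (induction rule: sigma_sets_induct_disjoint[where \<Omega> = UNIV])
    case (basic A)
    then obtain a where A: "A = {..a}"
      by auto
    show ?case
      unfolding step_approximable_def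
    proof (intro conjI allI impI)
      show "indicator A \<in> L2 cantor"
        by (rule L2) (simp add: A)
      fix \<epsilon> :: real assume "0 < \<epsilon>"
      then obtain n where n: "(1/2) ^ n < \<epsilon>"
        using real_arch_pow_inv[of \<epsilon> "1/2"] by auto
      obtain h where "step_fun n h" "h \<in> borel_measurable borel" "\<forall>x. cmod (h x) \<le> 1"
        "(L2_norm cantor (\<lambda>x. indicator A x - h x))\<^sup>2 \<le> (1/2) ^ n"
        using step_fun_approx_atMost[of n a] A by blast
      with n show "\<exists>n h. step_fun n h \<and> h \<in> L2 cantor \<and> (L2_norm cantor (\<lambda>x. indicator A x - h x))\<^sup>2 < \<epsilon>"
        by (intro exI[of _ n] exI[of _ h]) (auto intro: L2_cantor_bounded)
    qed
  next
    case empty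
    show ?case
      using step_approximable_const[of 0] by simp
  next
    case (compl A)
    have "indicator (UNIV - A) = (\<lambda>x. 1 + (- 1) * (indicator A x :: complex))"
      by (auto simp: indicator_def)
    then show ?case
      using step_approximable_add[OF step_approximable_const step_approximable_cmult[OF compl(2)], of 1 "- 1"]
      by simp
  next
    case (union A)
    have meas: "A i \<in> sets borel" for i
      using union(2) sets by auto
    have sum: "(\<Sum>i<n. indicator (A i) x) = (indicator (\<Union>i<n. A i) x :: complex)" for n x
      using union(1) disjoint_family_on_mono[of "{..<n}" UNIV A]
      by (subst indicator_UN_disjoint) auto
    show ?case
    proof (rule step_approximable_dominated_limit[where g = "\<lambda>n x. \<Sum>i<n. indicator (A i) x" and w = "\<lambda>_. 1"])
      show "step_approximable (\<lambda>x. \<Sum>i<n. indicator (A i) x)" for n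
        using union(3) by (intro step_approximable_sum) auto
      show "indicator (\<Union> (range A)) \<in> L2 cantor"
        by (intro L2 sets.countable_UN) (use meas in auto)
      show "(\<lambda>n. \<Sum>i<n. indicator (A i) x) \<longlonglongrightarrow> (indicator (\<Union> (range A)) x :: complex)" for x
        unfolding sum by (rule LIMSEQ_indicator_UN)
      show "cmod (indicator (\<Union> (range A)) x - (\<Sum>i<n. indicator (A i) x)) \<le> 1" for n x
        unfolding sum by (auto simp: indicator_def)
    qed simp
  qed
qed

lemma step_approximable_all:
  assumes f: "f \<in> L2 cantor"
  shows "step_approximable f"
proof -
  \<comment> \<open>The approximation is centred at 0, which gives the factor 2; the difference to
    \<open>f\<close> is then dominated by three times the modulus of \<open>f\<close>.\<close>
  obtain s where s: "\<And>i. simple_function cantor (s i)" "\<And>x. (\<lambda>i. s i x) \<longlonglongrightarrow> f x"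
    "\<And>i x. cmod (s i x) \<le> 2 * cmod (f x)"
    using borel_measurable_implies_sequence_metric[OF L2_measurable[OF f], of 0]
    by (auto simp: dist_norm norm_minus_commute)
  show ?thesis
  proof (rule step_approximable_dominated_limit[OF _ f s(2)])
    show "step_approximable (s i)" for i
    proof -
      have "step_approximable (\<lambda>x. \<Sum>y\<in>range (s i). y * indicator (s i -` {y}) x)"
        using s(1)[of i] simple_functionD(2)[OF s(1), of i]
        by (intro step_approximable_sum step_approximable_cmult step_approximable_indicator)
           (auto simp: simple_function_def)
      moreover have "(\<Sum>y\<in>range (s i). y * indicator (s i -` {y}) x) = s i x" for x
        using s(1)[of i] by (subst sum.remove[of _ "s i x"])
          (auto simp: simple_function_def indicator_def intro!: sum.neutral)
      ultimately show ?thesis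
        by simp
    qed
    show "integrable cantor (\<lambda>x. (3 * cmod (f x))\<^sup>2)"
      using L2_integrable_square[OF f] by (simp add: power_mult_distrib)
    show "cmod (f x - s i x) \<le> 3 * cmod (f x)" for i x
      using norm_triangle_ineq4[of "f x" "s i x"] s(3)[of i x] by simp
  qed
qed

section \<open>The frame inequality for \<open>cantor\<close>\<close>

lemma coef_add:
  assumes "f \<in> L2 cantor" "g \<in> L2 cantor"
  shows "coef (\<lambda>x. f x + g x) t = coef f t + coef g t"
  using integrable_coef[OF assms(1), of "- t"] integrable_coef[OF assms(2), of "- t"]
  by (simp add: coef_def ring_distribs)

lemma energy_add_le:
  assumes "f \<in> L2 cantor" "g \<in> L2 cantor"
  shows "energy T (\<lambda>x. f x + g x) \<le> 2 * energy T f + 2 * energy T g"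
  unfolding energy_def sum_distrib_left sum.distrib[symmetric] coef_add[OF assms]
  by (intro sum_mono cmod_add_square_le)

text \<open>The lower bound passes from a step function \<open>h\<close> to \<open>f\<close>. With
  \<open>?d\<close> the difference, \<open>?c\<close> times the squared norm of \<open>f\<close> is
  at most 4S plus 6 times the squared norm of \<open>?d\<close>: the factor 4 comes from using the
  inequality for squares of sums once for the norm and once for the energy.\<close>

lemma energy_ge:
  assumes f: "f \<in> L2 cantor" and S: "\<And>n. energy (freqs n) f \<le> S"
  shows "(cos (4 * pi / 9))\<^sup>2 / 4 * (L2_norm cantor f)\<^sup>2 \<le> S"
proof -
  let ?c = "(cos (4 * pi / 9))\<^sup>2"
  have "?c / 4 * (L2_norm cantor f)\<^sup>2 \<le> S + \<epsilon>" if pos: "0 < \<epsilon>" for \<epsilon>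
  proof -
    obtain n h where h: "step_fun n h" "h \<in> L2 cantor" "(L2_norm cantor (\<lambda>x. f x - h x))\<^sup>2 < \<epsilon> / 2"
      using step_approximableE[OF step_approximable_all[OF f] half_gt_zero[OF pos]] .
    let ?d = "\<lambda>x. f x - h x"
    have d: "?d \<in> L2 cantor" and d': "(\<lambda>x. - 1 * ?d x) \<in> L2 cantor"
      using L2_diff[OF f h(2)] L2_cmult by blast+
    have nd: "(L2_norm cantor (\<lambda>x. - 1 * ?d x))\<^sup>2 = (L2_norm cantor ?d)\<^sup>2"
      by (simp only: L2_norm_cmult_square) simp
    have "(\<lambda>x. expo (- 0) x * h x) = h"
      by (simp add: expo_def)
    then have "?c * (L2_norm cantor h)\<^sup>2 \<le> energy (freqs n) h"
      using energy_step_fun_ge[OF h(1,2), of 0] by simp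
    also have "\<dots> \<le> 2 * energy (freqs n) f + 2 * energy (freqs n) (\<lambda>x. - 1 * ?d x)"
      using energy_add_le[OF f d', of "freqs n"] by simp
    also have "\<dots> \<le> 2 * S + 2 * (L2_norm cantor ?d)\<^sup>2"
      using S[of n] energy_le[OF d', of n] nd by simp
    finally have 1: "?c * (L2_norm cantor h)\<^sup>2 \<le> 2 * S + 2 * (L2_norm cantor ?d)\<^sup>2" .
    have "?c * (L2_norm cantor f)\<^sup>2 \<le> ?c * (2 * (L2_norm cantor h)\<^sup>2 + 2 * (L2_norm cantor ?d)\<^sup>2)"
      using L2_norm_add_square_le[OF h(2) d] by (intro mult_left_mono) auto
    also have "\<dots> = 2 * (?c * (L2_norm cantor h)\<^sup>2) + 2 * (?c * (L2_norm cantor ?d)\<^sup>2)"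
      by (simp add: ring_distribs)
    also have "\<dots> \<le> 2 * (2 * S + 2 * (L2_norm cantor ?d)\<^sup>2) + 2 * (1 * (L2_norm cantor ?d)\<^sup>2)"
      by (intro add_mono mult_left_mono mult_right_mono 1) (auto simp: power_le_one_iff abs_square_le_1)
    finally show ?thesis
      using h(3) pos by simp
  qed
  then show ?thesis
    by (rule field_le_epsilon)
qed

text \<open>The integers with base-4 digits 0 and 1, which are the Jorgensen--Pedersen spectrum of
  \<open>cantor\<close>; here they enter through the frame inequalities.\<close>

definition spectrum :: "real set" where
  "spectrum = (\<Union>n. freqs n)"

lemma finite_subset_freqs:
  assumes "finite F" "F \<subseteq> spectrum"
  obtains n where "F \<subseteq> freqs n"
  using assms
proof (induction arbitrary: thesis rule: finite_induct)
  case (insert t F)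
  from insert.prems(2) obtain m where m: "t \<in> freqs m"
    by (auto simp: spectrum_def)
  obtain n where n: "F \<subseteq> freqs n"
    using insert by blast
  show ?case
    by (rule insert.prems(1)[of "max m n"])
       (use m n freqs_mono[of m "max m n"] freqs_mono[of n "max m n"] in auto)
qed auto

text \<open>A finite set of frequencies lies within one level, so \<open>energy_le\<close> bounds
  all finite partial sums. Conversely the infinite sum bounds the energy of every level, as
  \<open>energy_ge\<close> demands.\<close>

lemma cantor_frame:
  assumes f: "f \<in> L2 cantor"
  shows "(\<lambda>t. (cmod (coef f t))\<^sup>2) summable_on spectrum"
    and "(cos (4 * pi / 9))\<^sup>2 / 4 * (L2_norm cantor f)\<^sup>2 \<le> (\<Sum>\<^sub>\<infinity>t\<in>spectrum. (cmod (coef f t))\<^sup>2)"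
    and "(\<Sum>\<^sub>\<infinity>t\<in>spectrum. (cmod (coef f t))\<^sup>2) \<le> (L2_norm cantor f)\<^sup>2"
proof -
  have bound: "(\<Sum>t\<in>F. (cmod (coef f t))\<^sup>2) \<le> (L2_norm cantor f)\<^sup>2"
    if F: "finite F" "F \<subseteq> spectrum" for F
  proof -
    obtain n where "F \<subseteq> freqs n"
      using finite_subset_freqs[OF F] .
    then have "(\<Sum>t\<in>F. (cmod (coef f t))\<^sup>2) \<le> energy (freqs n) f"
      unfolding energy_def by (intro sum_mono2 finite_freqs) auto
    also have "\<dots> \<le> (L2_norm cantor f)\<^sup>2"
      by (rule energy_le[OF f])
    finally show ?thesis .
  qed
  show sum: "(\<lambda>t. (cmod (coef f t))\<^sup>2) summable_on spectrum"
    by (rule nonneg_bdd_above_summable_on) (auto intro!: bdd_aboveI[of _ "(L2_norm cantor f)\<^sup>2"] bound)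
  show "(\<Sum>\<^sub>\<infinity>t\<in>spectrum. (cmod (coef f t))\<^sup>2) \<le> (L2_norm cantor f)\<^sup>2"
    by (rule infsum_le_finite_sums[OF sum bound])
  show "(cos (4 * pi / 9))\<^sup>2 / 4 * (L2_norm cantor f)\<^sup>2 \<le> (\<Sum>\<^sub>\<infinity>t\<in>spectrum. (cmod (coef f t))\<^sup>2)"
  proof (rule energy_ge[OF f])
    show "energy (freqs n) f \<le> (\<Sum>\<^sub>\<infinity>t\<in>spectrum. (cmod (coef f t))\<^sup>2)" for n
      unfolding energy_def
      by (rule finite_sum_le_infsum[OF sum finite_freqs]) (auto simp: spectrum_def)
  qed
qed

section \<open>The tilted measure\<close>

definition tilt_mass :: real where
  "tilt_mass = (LINT x|cantor. exp x)"

definition tilt :: "real \<Rightarrow> real" where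
  "tilt x = exp x / tilt_mass"

definition tilted_cantor :: "real measure" where
  "tilted_cantor = density cantor tilt"

lemma integrable_cantor_real_exp: "integrable cantor (exp :: real \<Rightarrow> real)"
  by (rule integrable_cantor_bounded[of _ "exp 1"]) auto

lemma tilt_mass_ge: "1 \<le> tilt_mass"
proof -
  have "(LINT x|cantor. 1) \<le> tilt_mass"
    unfolding tilt_mass_def
  proof (rule integral_mono_AE)
    show "AE x in cantor. 1 \<le> exp x"
      using AE_cantor by eventually_elim simp
  qed (use integrable_cantor_real_exp in auto)
  then show ?thesis
    using cantor.prob_space by simp
qed

lemma tilt_measurable [measurable]: "tilt \<in> borel_measurable borel"
  unfolding tilt_def [abs_def] by measurable

lemma tilt_pos: "0 < tilt x"
  using tilt_mass_ge by (simp add: tilt_def)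

lemma tilt_ge: "x \<in> {0..2/3} \<Longrightarrow> 1 / tilt_mass \<le> tilt x"
  using tilt_mass_ge by (simp add: tilt_def divide_right_mono)

lemma tilt_le: "x \<in> {0..2/3} \<Longrightarrow> tilt x \<le> exp 1"
  using tilt_mass_ge frac_le[of "exp 1" "exp x" 1 tilt_mass] by (simp add: tilt_def)

lemma integrable_tilt: "integrable cantor tilt"
  unfolding tilt_def [abs_def] using integrable_cantor_real_exp by simp

lemma integral_tilt: "(LINT x|cantor. tilt x) = 1"
  using tilt_mass_ge integrable_cantor_real_exp
  by (simp add: tilt_def tilt_mass_def[symmetric])

lemma sets_tilted_cantor [measurable_cong, simp]: "sets tilted_cantor = sets borel"
  by (simp add: tilted_cantor_def)

lemma space_tilted_cantor [simp]: "space tilted_cantor = UNIV"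
  by (simp add: tilted_cantor_def)

lemma prob_space_tilted_cantor: "prob_space tilted_cantor"
proof (rule prob_spaceI)
  have "emeasure tilted_cantor (space tilted_cantor) = (\<integral>\<^sup>+x. tilt x \<partial>cantor)"
    by (simp add: tilted_cantor_def emeasure_density)
  also have "\<dots> = ennreal (LINT x|cantor. tilt x)"
    by (intro nn_integral_eq_integral integrable_tilt) (auto intro: less_imp_le tilt_pos)
  finally show "emeasure tilted_cantor (space tilted_cantor) = 1"
    by (simp add: integral_tilt)
qed

interpretation tilted: real_distribution tilted_cantor
  by (intro real_distribution.intro prob_space_tilted_cantor) (unfold_locales, simp_all)

text \<open>Absolute continuity carries singularity, absence of atoms and the bound on the support
  over from \<open>cantor\<close>.\<close>

lemma null_tilted_cantor:
  assumes "A \<in> sets borel" "emeasure cantor A = 0"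
  shows "emeasure tilted_cantor A = 0"
  using assms absolutely_continuousI_density[of tilt cantor]
  by (auto simp: tilted_cantor_def absolutely_continuous_def null_sets_def)

lemma atomless_tilted_cantor: "atomless tilted_cantor"
  unfolding atomless_def
  by (intro allI null_tilted_cantor) (simp_all add: cantor.emeasure_eq_measure measure_cantor_singleton)

lemma mutually_singular_tilted_cantor: "mutually_singular tilted_cantor lborel"
  using mutually_singular_cantor null_tilted_cantor by (auto simp: mutually_singular_def)

text \<open>The complement is the union of all open null sets. With the inclusion in
  \<open>{0..2/3}\<close> this yields compactness of the support.\<close>

lemma closed_measure_support: "closed (measure_support M)"
proof -
  have "- measure_support M = \<Union>{U. open U \<and> \<not> emeasure M U > 0}"
    by (auto simp: measure_support_def)
  then show ?thesis
    by (auto simp: closed_def)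
qed

lemma measure_support_tilted_cantor: "measure_support tilted_cantor \<subseteq> {0..2/3}"
proof
  fix x assume x: "x \<in> measure_support tilted_cantor"
  show "x \<in> {0..2/3}"
  proof (rule ccontr)
    assume "x \<notin> {0..2/3}"
    then have "emeasure tilted_cantor (- {0..2/3}) > 0"
      using x unfolding measure_support_def by (simp add: open_Compl)
    moreover have "emeasure tilted_cantor (- {0..2/3}) = 0"
      by (intro null_tilted_cantor) (simp_all add: cantor.emeasure_eq_measure measure_cantor_outside)
    ultimately show False
      by simp
  qed
qed

lemma compact_measure_support_tilted_cantor: "compact (measure_support tilted_cantor)"
  by (intro compact_eq_bounded_closed[THEN iffD2] conjI closed_measure_support
      bounded_subset[OF bounded_closed_interval measure_support_tilted_cantor])

lemma integral_tilted_cantor: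
  fixes f :: "real \<Rightarrow> complex"
  assumes "f \<in> borel_measurable borel"
  shows "(CLINT x|tilted_cantor. f x) = (CLINT x|cantor. of_real (tilt x) * f x)"
  unfolding tilted_cantor_def
  using assms by (subst integral_density) (auto simp: scaleR_conv_of_real less_imp_le tilt_pos)

section \<open>No two exponentials are orthogonal\<close>

lemma cnj_expo: "cnj (expo t x) = expo (- t) x"
  by (simp add: expo_cis cis_cnj)

lemma L2_inner_expo_nonzero: "L2_inner tilted_cantor (expo s) (expo t) \<noteq> 0"
proof -
  \<comment> \<open>The real part 1 is contributed by the density exp(x), the imaginary part by the
    two exponentials.\<close>
  let ?z = "Complex 1 (2 * pi * (s - t))"
  have "of_real (tilt x) * (expo s x * cnj (expo t x)) = exp (?z * of_real x) / of_real tilt_mass" for x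
  proof -
    have "?z * of_real x = of_real x + \<i> * of_real (2 * pi * ((s - t) * x))"
      by (simp add: complex_eq_iff)
    then have "exp (?z * of_real x) = of_real (exp x) * cis (2 * pi * ((s - t) * x))"
      by (simp add: exp_add cis_conv_exp exp_of_real)
    moreover have "expo s x * cnj (expo t x) = cis (2 * pi * ((s - t) * x))"
      unfolding cnj_expo expo_mult by (simp add: expo_cis)
    ultimately show ?thesis
      by (simp add: tilt_def)
  qed
  then have "L2_inner tilted_cantor (expo s) (expo t) = cantor_laplace ?z / of_real tilt_mass"
    unfolding L2_inner_def
    by (subst integral_tilted_cantor) (simp_all add: cantor_laplace_def, simp add: cnj_expo)
  then show ?thesis
    using cantor_laplace_nonzero[of ?z] tilt_mass_ge by simp
qed

lemma mutually_orthogonal_set_subset_singleton: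
  assumes "mutually_orthogonal_set tilted_cantor \<Lambda>"
  shows "\<exists>t. \<Lambda> \<subseteq> {t}"
proof -
  have "\<forall>s\<in>\<Lambda>. \<forall>t\<in>\<Lambda>. s = t"
    using assms L2_inner_expo_nonzero by (auto simp: mutually_orthogonal_set_def pairwise_def)
  then show ?thesis
    by blast
qed

text \<open>The Fourier coefficients of \<open>f\<close> for the tilted measure are those of
  \<open>tilt\<close> times \<open>f\<close> for \<open>cantor\<close>. In the squared modulus of
  this product one factor \<open>tilt\<close> is the density and the other lies between
  \<open>1 / tilt_mass\<close> and \<open>exp 1\<close> on \<open>{0..2/3}\<close>, so the two norms
  are comparable.\<close>

lemma L2_tilted_cantor:
  assumes f: "f \<in> L2 tilted_cantor"
  shows "(\<lambda>x. of_real (tilt x) * f x) \<in> L2 cantor"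
    and "(L2_norm cantor (\<lambda>x. of_real (tilt x) * f x))\<^sup>2 \<le> exp 1 * (L2_norm tilted_cantor f)\<^sup>2"
    and "(L2_norm tilted_cantor f)\<^sup>2 / tilt_mass \<le> (L2_norm cantor (\<lambda>x. of_real (tilt x) * f x))\<^sup>2"
proof -
  have [measurable]: "f \<in> borel_measurable borel"
    using L2_measurable[OF f] by (simp cong: measurable_cong_sets)
  have int: "integrable cantor (\<lambda>x. tilt x * (cmod (f x))\<^sup>2)"
    using L2_integrable_square[OF f] unfolding tilted_cantor_def
    by (subst (asm) integrable_density) (auto simp: less_imp_le tilt_pos)
  have norm: "(L2_norm tilted_cantor f)\<^sup>2 = (LINT x|cantor. tilt x * (cmod (f x))\<^sup>2)"
    unfolding tilted_cantor_def L2_norm_square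
    by (subst integral_density) (auto simp: less_imp_le tilt_pos)
  have sq: "(cmod (of_real (tilt x) * f x))\<^sup>2 = tilt x * (tilt x * (cmod (f x))\<^sup>2)" for x
    by (simp add: norm_mult power_mult_distrib power2_eq_square)
  have nonneg: "0 \<le> tilt x * (cmod (f x))\<^sup>2" for x
    using tilt_pos[of x] by simp
  have le: "AE x in cantor. (cmod (of_real (tilt x) * f x))\<^sup>2 \<le> exp 1 * (tilt x * (cmod (f x))\<^sup>2)"
    using AE_cantor unfolding sq by eventually_elim (intro mult_right_mono tilt_le nonneg)
  have ge: "AE x in cantor. 1 / tilt_mass * (tilt x * (cmod (f x))\<^sup>2) \<le> (cmod (of_real (tilt x) * f x))\<^sup>2"
    using AE_cantor unfolding sq by eventually_elim (intro mult_right_mono tilt_ge nonneg)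
  have int2: "integrable cantor (\<lambda>x. (cmod (of_real (tilt x) * f x))\<^sup>2)"
  proof (rule Bochner_Integration.integrable_bound)
    show "integrable cantor (\<lambda>x. exp 1 * (tilt x * (cmod (f x))\<^sup>2))"
      using int by simp
    show "AE x in cantor. norm ((cmod (of_real (tilt x) * f x))\<^sup>2) \<le> norm (exp 1 * (tilt x * (cmod (f x))\<^sup>2))"
      using le by eventually_elim (simp add: abs_of_nonneg nonneg)
  qed simp
  then show "(\<lambda>x. of_real (tilt x) * f x) \<in> L2 cantor"
    by (simp add: L2_def)
  show "(L2_norm cantor (\<lambda>x. of_real (tilt x) * f x))\<^sup>2 \<le> exp 1 * (L2_norm tilted_cantor f)\<^sup>2"
    using integral_mono_AE[OF int2 _ le] int by (simp add: norm, simp add: L2_norm_square)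
  show "(L2_norm tilted_cantor f)\<^sup>2 / tilt_mass \<le> (L2_norm cantor (\<lambda>x. of_real (tilt x) * f x))\<^sup>2"
    using integral_mono_AE[OF _ int2 ge] int by (simp add: norm, simp add: L2_norm_square)
qed

lemma frame_spectral_measure_tilted_cantor: "frame_spectral_measure tilted_cantor"
  unfolding frame_spectral_measure_def
proof (intro exI conjI ballI)
  \<comment> \<open>The witnesses are \<open>spectrum\<close>, \<open>?c / tilt_mass\<close> and
    \<open>exp 1\<close>: the bounds of \<open>cantor_frame\<close> combined with those of
    \<open>L2_tilted_cantor\<close>.\<close>
  let ?c = "(cos (4 * pi / 9))\<^sup>2 / 4"
  have "0 < cos (4 * pi / 9)"
    by (intro cos_gt_zero) auto
  then show "0 < ?c / tilt_mass"
    using tilt_mass_ge by simp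
  have "(cos (4 * pi / 9))\<^sup>2 \<le> 1"
    using \<open>0 < cos (4 * pi / 9)\<close> by (intro power_le_one) auto
  then have "?c / tilt_mass \<le> 1 / 1"
    using tilt_mass_ge by (intro frac_le) auto
  also have "\<dots> \<le> exp 1"
    by simp
  finally show "?c / tilt_mass \<le> exp 1" .
  fix f assume f: "f \<in> L2 tilted_cantor"
  have [measurable]: "f \<in> borel_measurable borel"
    using L2_measurable[OF f] by (simp cong: measurable_cong_sets)
  let ?g = "\<lambda>x. of_real (tilt x) * f x"
  note g = L2_tilted_cantor[OF f]
  have eq: "(CLINT x|tilted_cantor. f x * expo (- t) x) = coef ?g t" for t
    by (subst integral_tilted_cantor) (simp_all add: coef_def mult.assoc)
  show "(\<lambda>t. (cmod (CLINT x|tilted_cantor. f x * expo (- t) x))\<^sup>2) summable_on spectrum"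
    unfolding eq by (rule cantor_frame[OF g(1)])
  have "?c / tilt_mass * (L2_norm tilted_cantor f)\<^sup>2 \<le> ?c * (L2_norm cantor ?g)\<^sup>2"
    using mult_left_mono[OF g(3), of ?c] by simp
  also have "\<dots> \<le> (\<Sum>\<^sub>\<infinity>t\<in>spectrum. (cmod (CLINT x|tilted_cantor. f x * expo (- t) x))\<^sup>2)"
    unfolding eq by (rule cantor_frame[OF g(1)])
  finally show "?c / tilt_mass * (L2_norm tilted_cantor f)\<^sup>2
    \<le> (\<Sum>\<^sub>\<infinity>t\<in>spectrum. (cmod (CLINT x|tilted_cantor. f x * expo (- t) x))\<^sup>2)" .
  show "(\<Sum>\<^sub>\<infinity>t\<in>spectrum. (cmod (CLINT x|tilted_cantor. f x * expo (- t) x))\<^sup>2)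
    \<le> exp 1 * (L2_norm tilted_cantor f)\<^sup>2"
    unfolding eq by (rule order_trans[OF cantor_frame(3)[OF g(1)] g(2)])
qed

text \<open>Two disjoint sets of positive mass show that the space of square-integrable functions is
  not one-dimensional. Each contains one of the first-level pieces, and a positive density keeps
  positive mass positive.\<close>

lemma tilted_cantor_halves_pos:
  "0 < measure tilted_cantor {..1/3}" "0 < measure tilted_cantor {1/3<..}"
proof -
  have pos: "0 < measure tilted_cantor A" if [measurable]: "A \<in> sets borel" and A: "0 < measure cantor A" for A
  proof (rule ccontr)
    have tilt_nz: "ennreal (tilt x) \<noteq> 0" for x
      using tilt_pos[of x] by simp
    assume "\<not> 0 < measure tilted_cantor A"
    then have "emeasure tilted_cantor A = 0"
      using measure_nonneg[of tilted_cantor A] by (simp add: tilted.emeasure_eq_measure)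
    then have "AE x in cantor. x \<notin> A"
      unfolding tilted_cantor_def
      by (simp add: emeasure_density nn_integral_0_iff_AE indicator_def tilt_nz)
    then show False
      using A cantor.prob_eq_0[of A] by simp
  qed
  have full: "measure cantor B = 1" if "{0..2/3} \<subseteq> B" "B \<in> sets borel" for B
  proof -
    have "AE x in cantor. x \<in> B"
      using AE_cantor by eventually_elim (use that in blast)
    then show ?thesis
      using that by (simp add: cantor.prob_eq_1)
  qed
  have "measure cantor {x. x/4 \<in> {..1/3}} = 1" "measure cantor {x. x/4 + 1/2 \<in> {1/3<..}} = 1"
    by (rule full; force)+
  then have "0 < measure cantor {..1/3}" "0 < measure cantor {1/3<..}"
    by (subst measure_cantor; simp add: add_pos_nonneg add_nonneg_pos)+
  then show "0 < measure tilted_cantor {..1/3}" "0 < measure tilted_cantor {1/3<..}"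
    by (simp_all add: pos)
qed

text \<open>An orthonormal basis would have at most one member, \<open>expo t\<close>. The
  restriction of \<open>expo t\<close> to \<open>{..1/3}\<close> keeps a positive distance from all
  multiples d * \<open>expo t\<close>: the error has modulus |1 - d| on the left and |d| on the
  right.\<close>

lemma not_spectral_measure_tilted_cantor: "\<not> spectral_measure tilted_cantor"
proof
  assume "spectral_measure tilted_cantor"
  then obtain \<Lambda> where \<Lambda>: "L2_orthonormal_basis tilted_cantor expo \<Lambda>"
    by (auto simp: spectral_measure_def)
  then have "mutually_orthogonal_set tilted_cantor \<Lambda>"
    by (auto simp: L2_orthonormal_basis_def mutually_orthogonal_set_def pairwise_def)
  then obtain t where t: "\<Lambda> \<subseteq> {t}"
    using mutually_orthogonal_set_subset_singleton by blast
  let ?A = "{..1/3} :: real set"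
  let ?f = "\<lambda>x. indicator ?A x * expo t x"
  let ?m = "min (measure tilted_cantor {..1/3}) (measure tilted_cantor {1/3<..})"
  have "?f \<in> L2 tilted_cantor"
  proof -
    have "integrable tilted_cantor (\<lambda>x. (cmod (?f x))\<^sup>2)"
      by (rule tilted.integrable_const_bound[of _ 1]) (auto simp: norm_mult indicator_def)
    then show ?thesis
      by (simp add: L2_def)
  qed
  moreover have "0 < sqrt (?m / 2)"
    using tilted_cantor_halves_pos by simp
  moreover have "\<forall>f\<in>L2 tilted_cantor. \<forall>\<epsilon>>0. \<exists>F c. finite F \<and> F \<subseteq> \<Lambda> \<and>
      L2_norm tilted_cantor (\<lambda>x. f x - (\<Sum>i\<in>F. c i * expo i x)) < \<epsilon>"
    using \<Lambda> by (simp add: L2_orthonormal_basis_def)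
  ultimately have "\<exists>F c. finite F \<and> F \<subseteq> \<Lambda> \<and>
      L2_norm tilted_cantor (\<lambda>x. ?f x - (\<Sum>i\<in>F. c i * expo i x)) < sqrt (?m / 2)"
    by (simp only:)
  then obtain F c where F: "F \<subseteq> \<Lambda>"
    and less: "L2_norm tilted_cantor (\<lambda>x. ?f x - (\<Sum>i\<in>F. c i * expo i x)) < sqrt (?m / 2)"
    by (elim exE conjE)
  \<comment> \<open>The basis, and with it \<open>F\<close>, may be empty; the approximating sum is
    then 0.\<close>
  define d where "d = (if F = {} then 0 else c t)"
  have "F = {} \<or> F = {t}"
    using F t by auto
  then have sum: "(\<Sum>i\<in>F. c i * expo i x) = d * expo t x" for x
    by (auto simp: d_def)
  have "(cmod (?f x - d * expo t x))\<^sup>2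
      = (cmod (1 - d))\<^sup>2 * indicator {..1/3} x + (cmod d)\<^sup>2 * indicator {1/3<..} x" for x
  proof -
    have "?f x - d * expo t x = (indicator ?A x - d) * expo t x"
      by (simp add: left_diff_distrib)
    then show ?thesis
      by (cases "x \<le> 1/3") (simp_all add: norm_mult)
  qed
  then have "(L2_norm tilted_cantor (\<lambda>x. ?f x - d * expo t x))\<^sup>2
      = (cmod (1 - d))\<^sup>2 * measure tilted_cantor {..1/3} + (cmod d)\<^sup>2 * measure tilted_cantor {1/3<..}"
    by (simp add: L2_norm_square tilted.emeasure_eq_measure)
  \<comment> \<open>Apply the inequality for squares of sums to 1 = (1 - d) + d.\<close>
  moreover have "?m / 2 \<le> ((cmod (1 - d))\<^sup>2 + (cmod d)\<^sup>2) * ?m"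
  proof -
    have "1 \<le> 2 * ((cmod (1 - d))\<^sup>2 + (cmod d)\<^sup>2)"
      using cmod_add_square_le[of "1 - d" d] by simp
    then show ?thesis
      using mult_right_mono[of 1 _ ?m] tilted_cantor_halves_pos by fastforce
  qed
  moreover have "((cmod (1 - d))\<^sup>2 + (cmod d)\<^sup>2) * ?m
      \<le> (cmod (1 - d))\<^sup>2 * measure tilted_cantor {..1/3} + (cmod d)\<^sup>2 * measure tilted_cantor {1/3<..}"
    unfolding distrib_right by (intro add_mono mult_left_mono) auto
  ultimately have "?m / 2 \<le> (L2_norm tilted_cantor (\<lambda>x. ?f x - d * expo t x))\<^sup>2"
    by linarith
  then have "sqrt (?m / 2) \<le> L2_norm tilted_cantor (\<lambda>x. ?f x - d * expo t x)"
    by (intro real_le_lsqrt) (simp_all add: L2_norm_def)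
  with less show False
    by (simp add: sum)
qed

theorem theorem1p4:
  shows "\<exists>\<mu> :: real measure.
    real_distribution \<mu> \<and>
    compact (measure_support \<mu>) \<and>
    mutually_singular \<mu> lborel \<and>
    atomless \<mu> \<and>
    (\<forall>\<Lambda>. mutually_orthogonal_set \<mu> \<Lambda> \<longrightarrow> finite \<Lambda>) \<and>
    \<not> spectral_measure \<mu> \<and>
    frame_spectral_measure \<mu>"
proof (rule exI[of _ tilted_cantor], intro conjI allI impI)
  show "finite \<Lambda>" if "mutually_orthogonal_set tilted_cantor \<Lambda>" for \<Lambda>
    using mutually_orthogonal_set_subset_singleton[OF that] finite_subset by blast
qed (fact tilted.real_distribution_axioms compact_measure_support_tilted_cantor
    mutually_singular_tilted_cantor atomless_tilted_cantor
    not_spectral_measure_tilted_cantor frame_spectral_measure_tilted_cantor)+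

end
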